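(* Let $\mathcal{M}=(X,\mathcal{I})$ be a matroid of rank $k$ on a ground set of size $n$, let $f:2^X\to\mathbb{R}_{\ge0}$ be a monotone, normalized, $(\gamma,\beta)$-weakly submodular function (with $\gamma\in(0,1]$, $\beta\ge1$) given by a value oracle, and let $\epsilon>0$. Then there is a randomized algorithm (which need not know $\gamma$ or $\beta$) that with probability $1-o(1)$ returns a set $S\in\mathcal{I}$ satisfying $$f(S)\ge\left(\frac{\gamma^2(1-e^{-\phi(\gamma,\beta)})}{\phi(\gamma,\beta)}-\mathcal{O}(\epsilon)\right)f(O)$$ for any $O\in\mathcal{I}$, where $\phi(\gamma,\beta)=\gamma^2+\beta(1-\gamma)$. The algorithm runs in time $\tilde{\mathcal{O}}(nk^4\epsilon^{-3})$.
   Context: $f$ is monotone if $f(A)\le f(B)$ for $A\subseteq B$, normalized if $f(\emptyset)=0$; $f(e\mid A)=f(A\cup\{e\})-f(A)$. $f$ is $(\gamma,\beta)$-weakly submodular if for all $A\subseteq B\subseteq X$: $\gamma(f(B)-f(A))\le\sum_{e\in B\setminus A}f(e\mid A)$ and $\beta(f(B)-f(A))\ge\sum_{e\in B\setminus A}f(e\mid B\setminus\{e\})$. Running time is measured in value-oracle evaluations of $f$; $\tilde{\mathcal{O}}$ hides polylogarithmic factors. *)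

theory Defs
  imports "HOL-Probability.Probability"
begin

locale matroid =
  fixes X :: "'a set" and \<I> :: "'a set set"
  assumes finite_ground: "finite X"
    and indep_subset_ground: "A \<in> \<I> \<Longrightarrow> A \<subseteq> X"
    and indep_empty: "{} \<in> \<I>"
    and indep_mono: "A \<in> \<I> \<Longrightarrow> B \<subseteq> A \<Longrightarrow> B \<in> \<I>"
    and augmentation:
      "A \<in> \<I> \<Longrightarrow> B \<in> \<I> \<Longrightarrow> card A < card B \<Longrightarrow> \<exists>e\<in>B - A. A \<union> {e} \<in> \<I>"

definition matroid_rank :: "'a set set \<Rightarrow> nat" where
  "matroid_rank \<I> = Max (card ` \<I>)"

definition marginal :: "('a set \<Rightarrow> real) \<Rightarrow> 'a \<Rightarrow> 'a set \<Rightarrow> real" where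
  "marginal f e A = f (A \<union> {e}) - f A"

definition nonneg_set_fun :: "'a set \<Rightarrow> ('a set \<Rightarrow> real) \<Rightarrow> bool" where
  "nonneg_set_fun X f \<longleftrightarrow> (\<forall>A\<subseteq>X. 0 \<le> f A)"

definition monotone_set_fun :: "'a set \<Rightarrow> ('a set \<Rightarrow> real) \<Rightarrow> bool" where
  "monotone_set_fun X f \<longleftrightarrow> (\<forall>A B. A \<subseteq> B \<and> B \<subseteq> X \<longrightarrow> f A \<le> f B)"

definition normalized_set_fun :: "('a set \<Rightarrow> real) \<Rightarrow> bool" where
  "normalized_set_fun f \<longleftrightarrow> f {} = 0"

definition weakly_submodular :: "real \<Rightarrow> real \<Rightarrow> 'a set \<Rightarrow> ('a set \<Rightarrow> real) \<Rightarrow> bool" where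
  "weakly_submodular \<gamma> \<beta> X f \<longleftrightarrow>
     (\<forall>A B. A \<subseteq> B \<and> B \<subseteq> X \<longrightarrow>
        \<gamma> * (f B - f A) \<le> (\<Sum>e\<in>B - A. marginal f e A) \<and>
        \<beta> * (f B - f A) \<ge> (\<Sum>e\<in>B - A. marginal f e (B - {e})))"

definition phi :: "real \<Rightarrow> real \<Rightarrow> real" where
  "phi \<gamma> \<beta> = \<gamma>\<^sup>2 + \<beta> * (1 - \<gamma>)"

text \<open>
  Randomized algorithms with access to a value oracle, as adaptive randomized decision trees:
  stop with an output set, evaluate the set function at a set and continue depending on the
  value, or continue with a randomly chosen subtree. The set function enters only
  through the answers to queries.
\<close>

datatype 'a oracle_alg =
    Return "'a set"
  | Query "'a set" "real \<Rightarrow> 'a oracle_alg"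
  | Sample "'a oracle_alg pmf"

text \<open>
  Joint distribution of the output and of the list of oracle queries made (with repetitions,
  in order) when the oracle answers according to \<open>f\<close>.
\<close>

primrec exec :: "('a set \<Rightarrow> real) \<Rightarrow> 'a oracle_alg \<Rightarrow> ('a set \<times> 'a set list) pmf" where
  "exec f (Return S) = return_pmf (S, [])"
| "exec f (Query A c) = map_pmf (\<lambda>(S, qs). (S, A # qs)) (exec f (c (f A)))"
| "exec f (Sample p) = join_pmf (map_pmf (exec f) p)"

end

theory Submission imports Defs begin

text \<open>
  The algorithm is a local search for the potential
  $\Phi_\phi(S) = \sum_{\emptyset \neq B \subseteq S} f(B) \int_0^1 e^{\phi(p-1)} p^{|B|-1} (1-p)^{|S|-|B|} dp$.
  Suppose that no exchange $S - s + \pi(s)$ along an exchange bijection $\pi$ from $S$ to an optimal base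
  $O$ improves $\Phi_\phi$. Summing the changes of the potential over $s$, integration by parts turns the
  contribution of the removed elements into $f(S) - \phi F$, where $F$ is a weighted sum of $f$ over the
  subsets of $S$. Weak submodularity, applied for each subset $B \subseteq S$ separately, bounds the
  contribution of the added elements from below by $\frac{1-e^{-\phi}}{\phi} \gamma^2 f(O) - \phi F$
  as soon as $\phi \ge \phi(\gamma, \beta)$. The terms in $F$ cancel and leave the ratio.

  The changes of the potential are estimated by sampling, with error $\epsilon f(O)/k$. The value
  $\phi(\gamma,\beta)$ is unknown, and a fresh search for each of the $1/\epsilon$ guesses would be too expensive.
  But with the weight $e^{\phi(p-1)}$ left unnormalized, the potential increases when $\phi$ decreases, so a
  single search that goes through the guesses $1/(j\epsilon)$ for $j = 1, 2, \dots$ makes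
  $O(k \log k / \epsilon)$ improving exchanges in total. The scale of $f(O)$ is guessed up to a factor of two.
\<close>

section \<open>The weights\<close>

text \<open>A local optimum is good enough only if its guess is at least
  \<open>phi \<gamma> \<beta>\<close>, so the guesses have to approach this value from above. This
  is also the direction in which the potential grows, hence progress made under one guess is kept
  under the next. The guesses are evenly spaced in 1/\<phi> because \<open>rho \<phi>\<close> is
  1/\<phi> times a factor between 0 and 1, so that rounding costs an additive \<epsilon> in the
  ratio. The grids of guesses and scales are finite although \<gamma> and \<beta> are unknown: if
  the promised ratio is at most 4\<epsilon>, every independent set satisfies the claim; otherwise
  \<epsilon> is at most \<gamma> and at most 1/\<open>phi \<gamma> \<beta>\<close>, which limits
  both grids. The search cannot recognize the right guess or the right scale. It therefore records
  every base that looks locally optimal and compares their values at the end. A recorded base is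
  never lost, so only the steps of the single run at the right scale contribute to the failure
  probability. Dividing by p in the potential is harmless: for values of f up to M it stays below M
  times a harmonic number, which gives the logarithm in the number of exchanges.\<close>

definition wt :: "real \<Rightarrow> nat \<Rightarrow> nat \<Rightarrow> real" where
  "wt \<phi> a b = integral {0..1} (\<lambda>p. exp (\<phi> * (p - 1)) * (p ^ b * (1 - p) ^ (a - b)))"

text \<open>The mass of the density \<open>exp (\<phi> * (p - 1))\<close> on the unit interval, and
  hence the factor between sums weighted by \<open>wt\<close> and expectations over a random
  subset.\<close>

definition rho :: "real \<Rightarrow> real" where
  "rho \<phi> = (1 - exp (- \<phi>)) / \<phi>"

lemma wt_integrable [intro]:
  "(\<lambda>p. exp (\<phi> * (p - 1)) * (p ^ b * (1 - p) ^ c)) integrable_on {0..1::real}"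
  by (intro integrable_continuous_real continuous_intros)

lemma wt_nonneg: "0 \<le> wt \<phi> a b"
  unfolding wt_def by (rule integral_nonneg[OF wt_integrable]) auto

text \<open>Insert 1 = p + (1 - p) under the integral: one further element is either taken or left
  out.\<close>

lemma wt_split:
  assumes "b \<le> a"
  shows "wt \<phi> a b = wt \<phi> (Suc a) b + wt \<phi> (Suc a) (Suc b)"
  unfolding wt_def using assms
  by (subst Henstock_Kurzweil_Integration.integral_add[symmetric, OF wt_integrable wt_integrable])
    (auto intro!: Henstock_Kurzweil_Integration.integral_cong simp: Suc_diff_le algebra_simps)

lemma wt_antimono:
  assumes "\<phi>' \<le> \<phi>"
  shows "wt \<phi> a b \<le> wt \<phi>' a b"
  unfolding wt_def
proof (rule integral_le[OF wt_integrable wt_integrable])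
  fix p :: real assume p: "p \<in> {0..1}"
  then have "\<phi> * (p - 1) \<le> \<phi>' * (p - 1)"
    using assms by (intro mult_right_mono_neg) auto
  then show "exp (\<phi> * (p - 1)) * (p ^ b * (1 - p) ^ (a - b)) \<le>
      exp (\<phi>' * (p - 1)) * (p ^ b * (1 - p) ^ (a - b))"
    using p by (intro mult_right_mono) auto
qed

text \<open>Integrate the derivative of
  \<open>exp (\<phi> * (p - 1)) * (p ^ b * (1 - p) ^ (k - b))\<close>. The boundary value at 1
  survives only for \<open>b = k\<close>, the one at 0 only for \<open>b = 0\<close>. Exponents that
  truncate occur only with coefficient 0.\<close>

lemma wt_by_parts:
  assumes "b \<le> k"
  shows "real b * wt \<phi> (k - 1) (b - 1) - real (k - b) * wt \<phi> (k - 1) b =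
    (if b = k then 1 else 0) - (if b = 0 then exp (- \<phi>) else 0) - \<phi> * wt \<phi> k b"
proof -
  define F where "F p = exp (\<phi> * (p - 1)) * (p ^ b * (1 - p) ^ (k - b))" for p :: real
  define u where "u p = exp (\<phi> * (p - 1)) * (p ^ (b - 1) * (1 - p) ^ (k - 1 - (b - 1)))" for p :: real
  define v where "v p = exp (\<phi> * (p - 1)) * (p ^ b * (1 - p) ^ (k - 1 - b))" for p :: real
  have der: "(F has_real_derivative (\<phi> * F p + (real b * u p - real (k - b) * v p))) (at p)" for p
    unfolding F_def u_def v_def
    by (cases "b = 0") (rule derivative_eq_intros refl | simp add: algebra_simps)+
  have "((\<lambda>p. \<phi> * F p + (real b * u p - real (k - b) * v p)) has_integral (F 1 - F 0)) {0..1}"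
    by (rule fundamental_theorem_of_calculus)
      (auto intro!: has_field_derivative_at_within der simp flip: has_real_derivative_iff_has_vector_derivative)
  moreover have "((\<lambda>p. \<phi> * F p + (real b * u p - real (k - b) * v p)) has_integral
     (\<phi> * wt \<phi> k b + (real b * wt \<phi> (k - 1) (b - 1) - real (k - b) * wt \<phi> (k - 1) b))) {0..1}"
    unfolding wt_def F_def u_def v_def
    by (intro has_integral_add has_integral_diff has_integral_mult_right integrable_integral wt_integrable)
  ultimately have "F 1 - F 0 = \<phi> * wt \<phi> k b +
      (real b * wt \<phi> (k - 1) (b - 1) - real (k - b) * wt \<phi> (k - 1) b)"
    by (rule has_integral_unique)
  moreover have "F 1 = (if b = k then 1 else 0)" "F 0 = (if b = 0 then exp (- \<phi>) else 0)"
    using assms by (auto simp: F_def)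
  ultimately show ?thesis by simp
qed

section \<open>Sums of the weights over all subsets\<close>

lemma sum_Pow_insert:
  fixes g :: "'a set \<Rightarrow> 'b :: comm_monoid_add"
  assumes "finite A" "x \<notin> A"
  shows "(\<Sum>B\<in>Pow (insert x A). g B) = (\<Sum>B\<in>Pow A. g B + g (insert x B))"
proof -
  have inj: "inj_on (insert x) (Pow A)"
    using assms(2) by (auto simp: inj_on_def)
  have "(\<Sum>B\<in>Pow (insert x A). g B) = sum g (Pow A) + sum g (insert x ` Pow A)"
    unfolding Pow_insert using assms by (intro sum.union_disjoint) auto
  also have "sum g (insert x ` Pow A) = (\<Sum>B\<in>Pow A. g (insert x B))"
    by (simp add: sum.reindex[OF inj])
  finally show ?thesis by (simp add: sum.distrib)
qed

lemma binomial_weights_sum: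
  fixes p :: real
  assumes "finite A"
  shows "(\<Sum>B\<in>Pow A. p ^ card B * (1 - p) ^ (card A - card B)) = 1"
  using assms
proof (induction A rule: finite_induct)
  case (insert x A)
  have "p ^ card B * (1 - p) ^ (card (insert x A) - card B) +
      p ^ card (insert x B) * (1 - p) ^ (card (insert x A) - card (insert x B))
      = p ^ card B * (1 - p) ^ (card A - card B)" if "B \<in> Pow A" for B
  proof -
    have "finite B" "x \<notin> B" "card B \<le> card A"
      using that insert by (auto intro: finite_subset card_mono)
    then show ?thesis
      using insert(1,2) by (simp add: Suc_diff_le algebra_simps)
  qed
  then show ?case
    using insert by (simp add: sum_Pow_insert)
qed simp

lemma sum_wt:
  assumes "finite A" "\<phi> \<noteq> 0"
  shows "(\<Sum>B\<in>Pow A. wt \<phi> (card A) (card B)) = rho \<phi>"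
proof -
  have "(\<Sum>B\<in>Pow A. wt \<phi> (card A) (card B)) = integral {0..1} (\<lambda>p.
      \<Sum>B\<in>Pow A. exp (\<phi> * (p - 1)) * (p ^ card B * (1 - p) ^ (card A - card B)))"
    unfolding wt_def using assms by (subst integral_sum) auto
  also have "\<dots> = integral {0..1} (\<lambda>p. exp (\<phi> * (p - 1)))"
    using assms by (simp add: binomial_weights_sum flip: sum_distrib_left)
  also have "\<dots> = exp (\<phi> * (1 - 1)) / \<phi> - exp (\<phi> * (0 - 1)) / \<phi>"
    by (rule integral_unique, rule fundamental_theorem_of_calculus)
      (use assms in \<open>auto intro!: derivative_eq_intros simp flip: has_real_derivative_iff_has_vector_derivative\<close>)
  also have "\<dots> = rho \<phi>" by (simp add: rho_def diff_divide_distrib)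
  finally show ?thesis .
qed

lemma rho_pos: "0 < \<phi> \<Longrightarrow> 0 < rho \<phi>"
  by (auto simp: rho_def)

lemma rho_le_1: "0 < \<phi> \<Longrightarrow> rho \<phi> \<le> 1"
  using exp_ge_add_one_self[of "-\<phi>"] by (simp add: rho_def)

text \<open>Dropping the empty set from \<open>binomial_weights_sum\<close> and dividing by p gives
  (1 - (1 - p)^n) / p, which is this geometric sum; the polynomial form includes p = 0.\<close>

lemma nonempty_binomial_weights_sum:
  fixes p :: real
  assumes "finite A"
  shows "(\<Sum>B\<in>Pow A - {{}}. p ^ (card B - 1) * (1 - p) ^ (card A - card B)) =
    (\<Sum>i<card A. (1 - p) ^ i)"
  using assms
proof (induction A rule: finite_induct)
  case (insert x A)
  let ?g = "\<lambda>a B. p ^ (card B - 1) * (1 - p) ^ (a - card B)"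
  have "Pow (insert x A) - {{}} = (Pow A - {{}}) \<union> insert x ` Pow A"
    unfolding Pow_insert by auto
  moreover have "(Pow A - {{}}) \<inter> insert x ` Pow A = {}"
    using insert by auto
  moreover have inj: "inj_on (insert x) (Pow A)"
    using insert(2) by (auto simp: inj_on_def)
  ultimately have "sum (?g (card (insert x A))) (Pow (insert x A) - {{}}) =
      sum (?g (Suc (card A))) (Pow A - {{}}) + (\<Sum>B\<in>Pow A. ?g (Suc (card A)) (insert x B))"
    using insert by (simp add: sum.union_disjoint sum.reindex[OF inj])
  also have "sum (?g (Suc (card A))) (Pow A - {{}}) = (1 - p) * sum (?g (card A)) (Pow A - {{}})"
    unfolding sum_distrib_left
    by (intro sum.cong refl) (use insert(1) in \<open>auto simp: Suc_diff_le card_mono\<close>)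
  also have "(\<Sum>B\<in>Pow A. ?g (Suc (card A)) (insert x B)) =
      (\<Sum>B\<in>Pow A. p ^ card B * (1 - p) ^ (card A - card B))"
  proof (intro sum.cong refl)
    fix B assume "B \<in> Pow A"
    then have "finite B" "x \<notin> B" using insert by (auto intro: finite_subset)
    then show "?g (Suc (card A)) (insert x B) = p ^ card B * (1 - p) ^ (card A - card B)"
      by simp
  qed
  also have "\<dots> = 1" using insert by (simp add: binomial_weights_sum)
  finally show ?case
    using insert by (simp add: sum.lessThan_Suc_shift sum_distrib_left[symmetric] del: sum.lessThan_Suc)
qed simp

text \<open>The exponential factor is at most 1, its value for \<phi> = 0, and integrating the
  geometric sum term by term gives the harmonic number.\<close>

lemma sum_wt_nonempty_le_harm:
  assumes "finite A" "0 \<le> \<phi>"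
  shows "(\<Sum>B\<in>Pow A - {{}}. wt \<phi> (card A - 1) (card B - 1)) \<le> harm (card A)"
proof -
  have "wt \<phi> a b \<le> wt 0 a b" for a b
    using assms(2) by (rule wt_antimono)
  then have "(\<Sum>B\<in>Pow A - {{}}. wt \<phi> (card A - 1) (card B - 1)) \<le>
      (\<Sum>B\<in>Pow A - {{}}. wt 0 (card A - 1) (card B - 1))"
    by (rule sum_mono)
  also have "\<dots> = (\<Sum>B\<in>Pow A - {{}}. integral {0..1} (\<lambda>p.
      p ^ (card B - 1) * (1 - p) ^ (card A - card B)))"
  proof (intro sum.cong refl)
    fix B assume "B \<in> Pow A - {{}}"
    then have "card B > 0" using assms(1) by (auto intro: finite_subset simp: card_gt_0_iff)
    then have "card A - 1 - (card B - 1) = card A - card B" by simp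
    then show "wt 0 (card A - 1) (card B - 1) =
        integral {0..1} (\<lambda>p. p ^ (card B - 1) * (1 - p) ^ (card A - card B))"
      by (simp add: wt_def)
  qed
  also have "\<dots> = integral {0..1} (\<lambda>p. \<Sum>B\<in>Pow A - {{}}.
      p ^ (card B - 1) * (1 - p) ^ (card A - card B))"
    by (rule integral_sum[symmetric])
      (use assms in \<open>auto intro!: integrable_continuous_real continuous_intros\<close>)
  also have "\<dots> = integral {0..1} (\<lambda>p. \<Sum>i<card A. (1 - p) ^ i)"
    by (simp only: nonempty_binomial_weights_sum[OF assms(1)])
  also have "\<dots> = (\<Sum>i<card A. integral {0..1} (\<lambda>p::real. (1 - p) ^ i))"
    by (rule integral_sum) (auto intro!: integrable_continuous_real continuous_intros)
  also have "\<dots> = (\<Sum>i<card A. 1 / real (Suc i))"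
  proof (intro sum.cong refl)
    fix i :: nat
    have "((\<lambda>p::real. (1 - p) ^ i) has_integral
        (- ((1 - 1) ^ Suc i / real (Suc i)) - - ((1 - 0) ^ Suc i / real (Suc i)))) {0..1}"
    proof (rule fundamental_theorem_of_calculus)
      fix p :: real
      have "((\<lambda>p. - ((1 - p) ^ Suc i / real (Suc i))) has_real_derivative
          - (real (Suc i) * (1 - p) ^ i * (- 1) / real (Suc i))) (at p within {0..1})"
        by (rule derivative_eq_intros refl | simp)+
      then show "((\<lambda>p. - ((1 - p) ^ Suc i / real (Suc i))) has_vector_derivative (1 - p) ^ i)
          (at p within {0..1})"
        by (simp add: has_real_derivative_iff_has_vector_derivative)
    qed simp
    then show "integral {0..1} (\<lambda>p::real. (1 - p) ^ i) = 1 / real (Suc i)"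
      by (simp add: integral_unique)
  qed
  also have "\<dots> = harm (card A)"
    by (simp add: harm_def inverse_eq_divide sum.atLeast1_atMost_eq)
  finally show ?thesis .
qed

section \<open>Exchange properties of matroids\<close>

context matroid
begin

definition base :: "'a set \<Rightarrow> bool" where
  "base B \<longleftrightarrow> B \<in> \<I> \<and> card B = matroid_rank \<I>"

lemma finite_indep: "A \<in> \<I> \<Longrightarrow> finite A"
  using indep_subset_ground finite_ground finite_subset by blast

lemma finite_\<I>: "finite \<I>"
  using indep_subset_ground finite_ground by (intro finite_subset[of \<I> "Pow X"]) auto

lemma card_le_rank: "A \<in> \<I> \<Longrightarrow> card A \<le> matroid_rank \<I>"
  unfolding matroid_rank_def using finite_\<I> by auto

lemma base_exists: "\<exists>B. base B"
proof -
  have "matroid_rank \<I> \<in> card ` \<I>"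
    unfolding matroid_rank_def using finite_\<I> indep_empty by (intro Max_in) auto
  then show ?thesis by (auto simp: base_def)
qed

lemma extend_to_card:
  assumes "A \<in> \<I>" "B \<in> \<I>" "card A \<le> card B"
  shows "\<exists>C. A \<subseteq> C \<and> C \<subseteq> A \<union> B \<and> C \<in> \<I> \<and> card C = card B"
  using assms
proof (induction "card B - card A" arbitrary: A)
  case 0
  then show ?case by (intro exI[of _ A]) auto
next
  case (Suc d)
  then have "card A < card B" by linarith
  then obtain e where e: "e \<in> B - A" "A \<union> {e} \<in> \<I>"
    using augmentation[of A B] Suc.prems by blast
  have "card (A \<union> {e}) = Suc (card A)"
    using e finite_indep[OF Suc.prems(1)] by simp
  then have "\<exists>C. A \<union> {e} \<subseteq> C \<and> C \<subseteq> A \<union> {e} \<union> B \<and> C \<in> \<I> \<and> card C = card B"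
    using Suc.hyps e Suc.prems by (intro Suc.hyps(1)) auto
  then show ?case using e by blast
qed

lemma extend_to_base:
  assumes "A \<in> \<I>"
  shows "\<exists>B. base B \<and> A \<subseteq> B"
proof -
  obtain B where B: "base B" using base_exists by auto
  then have "card A \<le> card B" using assms card_le_rank by (simp add: base_def)
  then show ?thesis
    using extend_to_card[OF assms, of B] B by (auto simp: base_def)
qed

text \<open>\<open>D\<close> is the fundamental circuit of \<open>e\<close> with respect to
  \<open>T\<close>, without \<open>e\<close> itself. As \<open>insert e D\<close> is dependent, a
  base between \<open>D\<close> and \<open>D \<union> S\<close> omits \<open>e\<close>; repairing
  \<open>S - {e}\<close> from that base must then use an element of \<open>D\<close>, which works on
  both sides.\<close>

lemma symmetric_exchange:
  assumes S: "base S" and T: "base T" and e: "e \<in> S - T"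
  shows "\<exists>b \<in> T - S. base (insert b (S - {e})) \<and> base (insert e (T - {b}))"
proof -
  let ?k = "matroid_rank \<I>"
  have fin: "finite S" "finite T" and SI: "S \<in> \<I>" "T \<in> \<I>" and cards: "card S = ?k" "card T = ?k"
    using S T by (auto simp: base_def intro: finite_indep)
  define D where "D = {b \<in> T. insert e (T - {b}) \<in> \<I>}"
  have D: "D \<subseteq> T" "D \<in> \<I>" using SI indep_mono by (auto simp: D_def)
  \<comment> \<open>If \<open>insert e D\<close> were independent, it would extend within
    \<open>insert e T\<close> to some \<open>insert e (T - {b})\<close>. Then \<open>b\<close> would
    be in \<open>D\<close>, and so in the extension that omits it.\<close>
  have notin: "insert e D \<notin> \<I>"
  proof
    assume I: "insert e D \<in> \<I>"
    obtain C where C: "insert e D \<subseteq> C" "C \<subseteq> insert e D \<union> T" "C \<in> \<I>" "card C = card T"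
      using extend_to_card[OF I SI(2)] card_le_rank[OF I] cards by auto
    have "C - {e} \<subseteq> T" using C D by auto
    moreover have "card (C - {e}) < card T"
      using C(1,4) finite_indep[OF C(3)] by (metis card_Diff1_less insert_subset)
    ultimately obtain b where b: "b \<in> T" "b \<notin> C"
      using e by (metis DiffE DiffI less_irrefl singletonD subsetI subset_antisym)
    have "C = insert e (T - {b})"
    proof (rule card_subset_eq)
      show "C \<subseteq> insert e (T - {b})" using C D b by auto
      show "card C = card (insert e (T - {b}))"
        using e b fin C(4) by (simp add: card_gt_0_iff) (metis card_gt_0_iff empty_iff Suc_pred fin(2))
    qed (use fin in auto)
    then have "b \<in> D" using C b by (simp add: D_def)
    then show False using b C by auto
  qed
  obtain C where C: "D \<subseteq> C" "C \<subseteq> D \<union> S" "C \<in> \<I>" "card C = card S"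
    using extend_to_card[OF D(2) SI(1)] card_le_rank[OF D(2)] cards by auto
  have "e \<notin> C" using C notin indep_mono by (metis insert_subset)
  have SeI: "S - {e} \<in> \<I>" by (rule indep_mono[OF SI(1)]) auto
  have "card (S - {e}) < card C" using e C(4) card_Diff1_less[OF fin(1), of e] by simp
  then obtain b where b: "b \<in> C - (S - {e})" "S - {e} \<union> {b} \<in> \<I>"
    using augmentation[OF SeI C(3)] by auto
  have bD: "b \<in> D" and bS: "b \<notin> S" using b C \<open>e \<notin> C\<close> by auto
  have bT: "b \<in> T" using bD D by auto
  have pos: "card S > 0" using e fin by (auto simp: card_gt_0_iff)
  have "base (insert b (S - {e}))"
    using b(2) bS e fin cards pos by (simp add: base_def)
  moreover have "base (insert e (T - {b}))"
    using bD bT e fin cards pos by (simp add: base_def D_def)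
  ultimately show ?thesis using bT bS by auto
qed

text \<open>Brualdi's exchange bijection. A symmetric exchange replaces \<open>b\<close> by
  \<open>e\<close> in \<open>T\<close> and brings it closer to \<open>S\<close>. Since
  \<open>e\<close> lies in \<open>S\<close>, the bijection for the new base fixes \<open>e\<close>,
  and redirecting \<open>e\<close> to \<open>b\<close> gives one for \<open>T\<close>. The clause on
  fixed points drives this induction; later it makes every other image lie outside
  \<open>S\<close>.\<close>

lemma exchange_bijection:
  assumes S: "base S" and T: "base T"
  shows "\<exists>\<pi>. bij_betw \<pi> S T \<and> (\<forall>s\<in>S. insert (\<pi> s) (S - {s}) \<in> \<I>) \<and> (\<forall>s\<in>S. \<pi> s \<in> S \<longrightarrow> \<pi> s = s)"
  using T
proof (induction "card (S - T)" arbitrary: T)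
  case 0
  have "finite S" "finite T" "S \<in> \<I>" using S 0 by (auto simp: base_def intro: finite_indep)
  then have "S \<subseteq> T" using 0 by auto
  then have "S = T" using S 0 \<open>finite T\<close> by (intro card_subset_eq) (auto simp: base_def)
  then show ?case using \<open>S \<in> \<I>\<close> by (intro exI[of _ id]) (auto simp: insert_absorb bij_betw_def)
next
  case (Suc d)
  have fin: "finite S" "finite T" using S Suc by (auto simp: base_def intro: finite_indep)
  have "S - T \<noteq> {}"
  proof
    assume "S - T = {}"
    then have "card (S - T) = 0" by (simp only: card.empty)
    then show False using Suc.hyps(2) by simp
  qed
  then obtain e where e: "e \<in> S - T" by auto
  obtain b where b: "b \<in> T - S" "base (insert b (S - {e}))" "base (insert e (T - {b}))"
    using symmetric_exchange[OF S Suc.prems e] by auto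
  let ?T = "insert e (T - {b})"
  have "S - ?T = (S - T) - {e}" using b by auto
  then have "d = card (S - ?T)" using Suc.hyps(2) e fin by simp
  then obtain \<pi> where \<pi>: "bij_betw \<pi> S ?T" "\<forall>s\<in>S. insert (\<pi> s) (S - {s}) \<in> \<I>"
      "\<forall>s\<in>S. \<pi> s \<in> S \<longrightarrow> \<pi> s = s"
    using Suc.hyps(1)[OF _ b(3)] by auto
  have "e \<in> \<pi> ` S" using \<pi>(1) by (auto simp: bij_betw_def)
  then have \<pi>e: "\<pi> e = e" using \<pi>(3) e by auto
  have "bij_betw \<pi> (S - {e}) (T - {b})"
  proof -
    have "?T - {e} = T - {b}" using e by auto
    moreover have "\<pi> ` (S - {e}) = \<pi> ` S - {e}"
      using inj_on_image_set_diff[of \<pi> S S "{e}"] \<pi>(1) \<pi>e e by (simp add: bij_betw_def)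
    ultimately show ?thesis using \<pi>(1)
      by (intro bij_betw_subset[OF \<pi>(1)]) (auto simp: bij_betw_def)
  qed
  then have "bij_betw (\<pi>(e := b)) (S - {e}) (T - {b})"
    by (subst bij_betw_cong[of _ _ \<pi>]) auto
  then have "bij_betw (\<pi>(e := b)) (insert e (S - {e})) (insert b (T - {b}))"
    using notIn_Un_bij_betw[of e "S - {e}" "\<pi>(e := b)" "T - {b}"] by simp
  moreover have "insert e (S - {e}) = S" "insert b (T - {b}) = T" using e b by auto
  ultimately have "bij_betw (\<pi>(e := b)) S T" by simp
  then show ?case using \<pi> b by (intro exI[of _ "\<pi>(e := b)"]) (auto simp: base_def)
qed

end

section \<open>The potential and its local optima\<close>

definition potential :: "real \<Rightarrow> ('a set \<Rightarrow> real) \<Rightarrow> 'a set \<Rightarrow> real" where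
  "potential \<phi> f S = (\<Sum>B\<in>Pow S - {{}}. wt \<phi> (card S - 1) (card B - 1) * f B)"

text \<open>Subsets avoiding both elements cancel in the change of the potential. For positive
  \<phi> what remains is \<open>rho \<phi>\<close> times an expectation over random subsets of
  \<open>S - {s}\<close>, a quantity that can be sampled.\<close>

definition swap_gain :: "real \<Rightarrow> ('a set \<Rightarrow> real) \<Rightarrow> 'a set \<Rightarrow> 'a \<Rightarrow> 'a \<Rightarrow> real" where
  "swap_gain \<phi> f S s e =
     (\<Sum>B\<in>Pow (S - {s}). wt \<phi> (card S - 1) (card B) * (f (insert e B) - f (insert s B)))"

lemma potential_insert:
  assumes "finite R" "x \<notin> R"
  shows "potential \<phi> f (insert x R) =
    (\<Sum>B\<in>Pow R - {{}}. wt \<phi> (card R) (card B - 1) * f B) +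
    (\<Sum>B\<in>Pow R. wt \<phi> (card R) (card B) * f (insert x B))"
proof -
  let ?g = "\<lambda>B. wt \<phi> (card R) (card B - 1) * f B"
  have split: "Pow (insert x R) - {{}} = (Pow R - {{}}) \<union> insert x ` Pow R"
    unfolding Pow_insert by auto
  have inj: "inj_on (insert x) (Pow R)"
    using assms(2) by (auto simp: inj_on_def)
  have "potential \<phi> f (insert x R) = sum ?g (Pow (insert x R) - {{}})"
    using assms by (simp add: potential_def)
  also have "\<dots> = sum ?g (Pow R - {{}}) + sum ?g (insert x ` Pow R)"
    unfolding split using assms by (intro sum.union_disjoint) auto
  also have "sum ?g (insert x ` Pow R) = (\<Sum>B\<in>Pow R. ?g (insert x B))"
    by (simp add: sum.reindex[OF inj])
  also have "\<dots> = (\<Sum>B\<in>Pow R. wt \<phi> (card R) (card B) * f (insert x B))"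
  proof (intro sum.cong refl)
    fix B assume "B \<in> Pow R"
    then have "finite B" "x \<notin> B" using assms by (auto intro: finite_subset)
    then show "?g (insert x B) = wt \<phi> (card R) (card B) * f (insert x B)" by simp
  qed
  finally show ?thesis .
qed

lemma potential_swap:
  assumes "finite S" "s \<in> S" "e \<notin> S"
  shows "potential \<phi> f (insert e (S - {s})) = potential \<phi> f S + swap_gain \<phi> f S s e"
proof -
  define R where "R = S - {s}"
  have R: "finite R" "s \<notin> R" "e \<notin> R" "S = insert s R" "card S - 1 = card R"
    using assms by (auto simp: R_def)
  show ?thesis
    unfolding R_def[symmetric] swap_gain_def R(5)
    unfolding R(4) potential_insert[OF R(1,2)] potential_insert[OF R(1,3)]
    by (simp add: algebra_simps sum_subtractf)
qed

lemma potential_antimono: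
  assumes "\<phi>' \<le> \<phi>" "\<And>B. B \<subseteq> S \<Longrightarrow> 0 \<le> f B"
  shows "potential \<phi> f S \<le> potential \<phi>' f S"
  unfolding potential_def by (intro sum_mono mult_right_mono wt_antimono) (use assms in auto)

lemma potential_nonneg:
  assumes "\<And>B. B \<subseteq> S \<Longrightarrow> 0 \<le> f B"
  shows "0 \<le> potential \<phi> f S"
  unfolding potential_def by (intro sum_nonneg mult_nonneg_nonneg wt_nonneg) (use assms in auto)

lemma potential_le_harm:
  assumes "finite S" "0 \<le> \<phi>" "0 \<le> M" "\<And>B. B \<subseteq> S \<Longrightarrow> f B \<le> M"
  shows "potential \<phi> f S \<le> harm (card S) * M"
proof -
  have "potential \<phi> f S \<le> (\<Sum>B\<in>Pow S - {{}}. wt \<phi> (card S - 1) (card B - 1) * M)"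
    unfolding potential_def by (intro sum_mono mult_left_mono wt_nonneg) (use assms in auto)
  also have "\<dots> = (\<Sum>B\<in>Pow S - {{}}. wt \<phi> (card S - 1) (card B - 1)) * M"
    by (simp add: sum_distrib_right)
  also have "\<dots> \<le> harm (card S) * M"
    by (intro mult_right_mono sum_wt_nonempty_le_harm assms)
  finally show ?thesis .
qed

text \<open>Deleting \<open>s\<close> from a random subset of \<open>S\<close> gives a random subset
  of \<open>S - {s}\<close>. This provides one index set for all \<open>s\<close>, so that the
  exchanges can be summed for each fixed \<open>B\<close>.\<close>

lemma sum_wt_remove:
  assumes "finite S" "s \<in> S"
  shows "(\<Sum>B\<in>Pow (S - {s}). wt \<phi> (card S - 1) (card B) * h B) =
    (\<Sum>B\<in>Pow S. wt \<phi> (card S) (card B) * h (B - {s}))"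
proof -
  define R where "R = S - {s}"
  have R: "finite R" "s \<notin> R" "S = insert s R" "card S = Suc (card R)"
    using assms card_Suc_Diff1[OF assms] by (auto simp: R_def)
  have "(\<Sum>B\<in>Pow S. wt \<phi> (card S) (card B) * h (B - {s})) =
      (\<Sum>B\<in>Pow R. wt \<phi> (card R) (card B) * h B)"
    unfolding R(4) unfolding R(3) sum_Pow_insert[OF R(1,2)]
  proof (intro sum.cong refl)
    fix B assume "B \<in> Pow R"
    then have "finite B" "s \<notin> B" "card B \<le> card R" using R by (auto intro: finite_subset card_mono)
    then show "wt \<phi> (Suc (card R)) (card B) * h (B - {s}) +
        wt \<phi> (Suc (card R)) (card (insert s B)) * h (insert s B - {s}) = wt \<phi> (card R) (card B) * h B"
      using wt_split[of "card B" "card R" \<phi>] by (simp add: algebra_simps)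
  qed
  then show ?thesis by (simp add: R(4) flip: R_def)
qed

text \<open>Collect the coefficient of each \<open>f B\<close>: it occurs positively for the
  \<open>s\<close> in \<open>B\<close> and negatively for the \<open>s\<close> outside. The
  difference is the left-hand side of \<open>wt_by_parts\<close>, whose boundary terms belong to
  \<open>B = S\<close> and \<open>B = {}\<close>.\<close>

lemma sum_wt_marginals:
  assumes "finite S"
  shows "(\<Sum>s\<in>S. \<Sum>B\<in>Pow (S - {s}). wt \<phi> (card S - 1) (card B) * (f (insert s B) - f B)) =
    f S - exp (- \<phi>) * f {} - \<phi> * (\<Sum>B\<in>Pow S. wt \<phi> (card S) (card B) * f B)"
proof -
  let ?k = "card S"
  have inner: "(\<Sum>B\<in>Pow (S - {s}). wt \<phi> (?k - 1) (card B) * (f (insert s B) - f B)) =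
      (\<Sum>B\<in>Pow S. if s \<in> B then wt \<phi> (?k - 1) (card B - 1) * f B
         else - (wt \<phi> (?k - 1) (card B) * f B))" (is "_ = (\<Sum>B\<in>Pow S. ?g s B)") if s: "s \<in> S" for s
  proof -
    define R where "R = S - {s}"
    have R: "finite R" "s \<notin> R" "S = insert s R"
      using assms s by (auto simp: R_def)
    have "(\<Sum>B\<in>Pow S. ?g s B) = (\<Sum>B\<in>Pow R. ?g s B + ?g s (insert s B))"
      by (subst R(3)) (rule sum_Pow_insert[OF R(1,2)])
    also have "\<dots> = (\<Sum>B\<in>Pow R. wt \<phi> (?k - 1) (card B) * (f (insert s B) - f B))"
    proof (intro sum.cong refl)
      fix B assume "B \<in> Pow R"
      then have "finite B" "s \<notin> B" using R by (auto intro: finite_subset)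
      then show "?g s B + ?g s (insert s B) = wt \<phi> (?k - 1) (card B) * (f (insert s B) - f B)"
        by (simp add: algebra_simps)
    qed
    finally show ?thesis by (simp add: R_def)
  qed
  have "(\<Sum>s\<in>S. \<Sum>B\<in>Pow (S - {s}). wt \<phi> (?k - 1) (card B) * (f (insert s B) - f B)) =
      (\<Sum>B\<in>Pow S. \<Sum>s\<in>S. ?g s B)"
    by (subst sum.swap) (intro sum.cong refl inner)
  also have "\<dots> = (\<Sum>B\<in>Pow S. (if B = S then f S else 0) - (if B = {} then exp (- \<phi>) * f {} else 0)
      - \<phi> * (wt \<phi> ?k (card B) * f B))"
  proof (intro sum.cong refl)
    fix B assume B: "B \<in> Pow S"
    then have fin: "finite B" and le: "card B \<le> ?k" using assms by (auto intro: finite_subset card_mono)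
    have eqS: "card B = ?k \<longleftrightarrow> B = S" using B assms card_subset_eq by blast
    have "(\<Sum>s\<in>S. ?g s B) = (\<Sum>s\<in>S \<inter> B. wt \<phi> (?k - 1) (card B - 1) * f B)
        + (\<Sum>s\<in>S - B. - (wt \<phi> (?k - 1) (card B) * f B))"
      using assms by (simp add: sum.If_cases Diff_eq)
    also have "\<dots> = (real (card B) * wt \<phi> (?k - 1) (card B - 1)
        - real (?k - card B) * wt \<phi> (?k - 1) (card B)) * f B"
      using B fin by (simp add: Int_absorb1 card_Diff_subset algebra_simps)
    also have "\<dots> = (if B = S then f S else 0) - (if B = {} then exp (- \<phi>) * f {} else 0)
      - \<phi> * (wt \<phi> ?k (card B) * f B)"
      unfolding wt_by_parts[OF le] eqS using fin by (auto simp: algebra_simps)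
    finally show "(\<Sum>s\<in>S. ?g s B) = \<dots>" .
  qed
  also have "\<dots> = f S - exp (- \<phi>) * f {} - \<phi> * (\<Sum>B\<in>Pow S. wt \<phi> ?k (card B) * f B)"
    using assms by (simp add: sum_subtractf sum.delta sum_distrib_left)
  finally show ?thesis .
qed

section \<open>Weak submodularity and the ratio of a local optimum\<close>

locale weakly_submodular_matroid = matroid X \<I>
  for X :: "'a set" and \<I> :: "'a set set" +
  fixes f :: "'a set \<Rightarrow> real" and \<gamma> \<beta> :: real
  assumes \<gamma>: "0 < \<gamma>" "\<gamma> \<le> 1" and \<beta>: "1 \<le> \<beta>"
    and nonneg: "nonneg_set_fun X f" and mono: "monotone_set_fun X f"
    and normalized: "normalized_set_fun f" and weak: "weakly_submodular \<gamma> \<beta> X f"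
begin

lemma f_nonneg: "A \<subseteq> X \<Longrightarrow> 0 \<le> f A"
  using nonneg by (auto simp: nonneg_set_fun_def)

lemma f_mono: "A \<subseteq> B \<Longrightarrow> B \<subseteq> X \<Longrightarrow> f A \<le> f B"
  using mono by (auto simp: monotone_set_fun_def)

lemma f_empty: "f {} = 0"
  using normalized by (auto simp: normalized_set_fun_def)

lemma weak_lower:
  "A \<subseteq> B \<Longrightarrow> B \<subseteq> X \<Longrightarrow> \<gamma> * (f B - f A) \<le> (\<Sum>e\<in>B - A. f (insert e A) - f A)"
  using weak by (auto simp: weakly_submodular_def marginal_def)

lemma weak_upper:
  assumes "B \<subseteq> X"
  shows "(\<Sum>e\<in>B. f B - f (B - {e})) \<le> \<beta> * f B"
proof -
  have "(\<Sum>e\<in>B - {}. marginal f e (B - {e})) \<le> \<beta> * (f B - f {})"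
    using weak assms unfolding weakly_submodular_def by blast
  moreover have "(\<Sum>e\<in>B - {}. marginal f e (B - {e})) = (\<Sum>e\<in>B. f B - f (B - {e}))"
    by (intro sum.cong) (auto simp: marginal_def insert_absorb)
  ultimately show ?thesis by (simp add: f_empty)
qed

text \<open>Keeps the unknown value away from 0, so that the index of the right guess is at most
  2/\<epsilon>.\<close>

lemma phi_ge_half: "1 / 2 \<le> phi \<gamma> \<beta>"
proof -
  have "1 * (1 - \<gamma>) \<le> \<beta> * (1 - \<gamma>)" using \<gamma> \<beta> by (intro mult_right_mono) auto
  moreover have "0 \<le> (\<gamma> - 1 / 2)\<^sup>2" by simp
  ultimately show ?thesis by (simp add: phi_def power2_eq_square algebra_simps)
qed

text \<open>The origin of \<open>phi\<close>. If \<open>s\<close> stays in \<open>B\<close>, the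
  marginals of the incoming elements sum to at least \<gamma> (f(T) - f(B)). Removing
  \<open>s\<close> beforehand costs a factor \<gamma> and (1 - \<gamma>) times the marginal of
  \<open>s\<close>; by the upper inequality the marginals of all \<open>s\<close> in
  \<open>B\<close> sum to at most \<beta> f(B). Together f(B) receives the coefficient -(\<gamma>^2
  + \<beta> (1 - \<gamma>)).\<close>

lemma exchange_marginals:
  assumes S: "S \<subseteq> X" and T: "T \<subseteq> X" and bij: "bij_betw \<pi> S T"
    and fixed: "\<And>s. s \<in> S \<Longrightarrow> \<pi> s \<in> S \<Longrightarrow> \<pi> s = s" and B: "B \<subseteq> S"
  shows "\<gamma>\<^sup>2 * f T - phi \<gamma> \<beta> * f B \<le> (\<Sum>s\<in>S. f (insert (\<pi> s) (B - {s})) - f (B - {s}))"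
proof -
  have BX: "B \<subseteq> X" using B S by auto
  have finS: "finite S" "finite T" "finite B" using S T BX finite_ground by (auto intro: finite_subset)
  have \<pi>T: "\<pi> s \<in> T" if "s \<in> S" for s using bij that by (auto simp: bij_betw_def)
  have one: "\<gamma> * (f (insert (\<pi> s) B) - f B) - (1 - \<gamma>) * (if s \<in> B then f B - f (B - {s}) else 0)
      \<le> f (insert (\<pi> s) (B - {s})) - f (B - {s})" if s: "s \<in> S" for s
  proof -
    have ins: "insert (\<pi> s) B \<subseteq> X" using \<pi>T[OF s] T BX by auto
    show ?thesis
    proof (cases "s \<in> B")
      case False
      have "f B \<le> f (insert (\<pi> s) B)" using ins by (intro f_mono) auto
      then have "\<gamma> * (f (insert (\<pi> s) B) - f B) \<le> 1 * (f (insert (\<pi> s) B) - f B)"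
        using \<gamma> by (intro mult_right_mono) auto
      then show ?thesis using False by simp
    next
      case True
      show ?thesis
      proof (cases "\<pi> s = s")
        case eq: True
        have "f (B - {s}) \<le> f B" using BX by (intro f_mono) auto
        then have "0 \<le> (1 - \<gamma>) * (f B - f (B - {s}))" using \<gamma> by simp
        then show ?thesis using True eq \<open>f (B - {s}) \<le> f B\<close> by (simp add: insert_absorb)
      next
        case neq: False
        then have "\<pi> s \<notin> B" using fixed[OF s] B by auto
        then have "insert (\<pi> s) B - (B - {s}) = {s, \<pi> s}" using True by auto
        \<comment> \<open>The lower inequality for adding both \<open>s\<close> and
          \<open>\<pi> s\<close> to \<open>B - {s}\<close>. Moving the marginal of \<open>s\<close>
          to the other side leaves the fraction 1 - \<gamma> of it.\<close>
        then have "\<gamma> * (f (insert (\<pi> s) B) - f (B - {s})) \<le>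
            (\<Sum>e\<in>{s, \<pi> s}. f (insert e (B - {s})) - f (B - {s}))"
          using weak_lower[of "B - {s}" "insert (\<pi> s) B"] ins by auto
        also have "\<dots> = (f B - f (B - {s})) + (f (insert (\<pi> s) (B - {s})) - f (B - {s}))"
          using neq True by (simp add: insert_absorb)
        finally show ?thesis using True by (simp add: algebra_simps)
      qed
    qed
  qed
  have "(\<Sum>s\<in>S. f (insert (\<pi> s) B) - f B) = (\<Sum>e\<in>T. f (insert e B) - f B)"
    by (rule sum.reindex_bij_betw[OF bij])
  also have "\<dots> = (\<Sum>e\<in>(T \<union> B) - B. f (insert e B) - f B)"
    by (rule sum.mono_neutral_right) (use finS in \<open>auto simp: insert_absorb\<close>)
  also have "\<dots> \<ge> \<gamma> * (f (T \<union> B) - f B)"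
    using T BX by (intro weak_lower) auto
  finally have 1: "\<gamma> * (f (T \<union> B) - f B) \<le> (\<Sum>s\<in>S. f (insert (\<pi> s) B) - f B)" .
  have "f T \<le> f (T \<union> B)" using T BX by (intro f_mono) auto
  then have "\<gamma> * (f T - f B) \<le> \<gamma> * (f (T \<union> B) - f B)" using \<gamma> by simp
  from order_trans[OF this 1]
  have 1: "\<gamma> * (\<gamma> * (f T - f B)) \<le> \<gamma> * (\<Sum>s\<in>S. f (insert (\<pi> s) B) - f B)"
    using \<gamma> by (intro mult_left_mono) auto
  have "(\<Sum>s\<in>S. if s \<in> B then f B - f (B - {s}) else 0) = (\<Sum>s\<in>B. f B - f (B - {s}))"
    using B finS by (simp add: sum.If_cases Int_absorb1)
  also have "\<dots> \<le> \<beta> * f B" by (rule weak_upper[OF BX])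
  finally have 2: "(1 - \<gamma>) * (\<Sum>s\<in>S. if s \<in> B then f B - f (B - {s}) else 0) \<le> (1 - \<gamma>) * (\<beta> * f B)"
    using \<gamma> by (intro mult_left_mono) auto
  have "\<gamma>\<^sup>2 * f T - phi \<gamma> \<beta> * f B = \<gamma> * (\<gamma> * (f T - f B)) - (1 - \<gamma>) * (\<beta> * f B)"
    by (simp add: phi_def power2_eq_square algebra_simps)
  also have "\<dots> \<le> \<gamma> * (\<Sum>s\<in>S. f (insert (\<pi> s) B) - f B)
      - (1 - \<gamma>) * (\<Sum>s\<in>S. if s \<in> B then f B - f (B - {s}) else 0)"
    using 1 2 by linarith
  also have "\<dots> = (\<Sum>s\<in>S. \<gamma> * (f (insert (\<pi> s) B) - f B)
      - (1 - \<gamma>) * (if s \<in> B then f B - f (B - {s}) else 0))"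
    by (subst sum_subtractf) (simp only: sum_distrib_left)
  also have "\<dots> \<le> (\<Sum>s\<in>S. f (insert (\<pi> s) (B - {s})) - f (B - {s}))"
    by (intro sum_mono one)
  finally show ?thesis .
qed

text \<open>As \<open>f B\<close> is nonnegative, replacing \<open>phi \<gamma> \<beta>\<close> by a
  larger \<phi> only weakens \<open>exchange_marginals\<close>, and then the coefficient matches the
  one from integration by parts exactly. The tolerance \<open>t\<close> is paid once per element of
  the base.\<close>

lemma local_optimum:
  assumes S: "base S" and T: "base T" and \<phi>: "phi \<gamma> \<beta> \<le> \<phi>" and t: "0 \<le> t"
    and opt: "\<And>s e. s \<in> S \<Longrightarrow> e \<in> X - S \<Longrightarrow> insert e (S - {s}) \<in> \<I> \<Longrightarrow> swap_gain \<phi> f S s e \<le> t"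
  shows "rho \<phi> * \<gamma>\<^sup>2 * f T - real (matroid_rank \<I>) * t \<le> f S"
proof -
  let ?k = "card S"
  let ?F = "\<Sum>B\<in>Pow S. wt \<phi> ?k (card B) * f B"
  have k: "?k = matroid_rank \<I>" using S by (simp add: base_def)
  have sub: "S \<subseteq> X" "T \<subseteq> X" using S T indep_subset_ground by (auto simp: base_def)
  have fin: "finite S" using S finite_indep by (auto simp: base_def)
  have "0 < \<phi>" using \<phi> phi_ge_half by linarith
  obtain \<pi> where \<pi>: "bij_betw \<pi> S T" "\<forall>s\<in>S. insert (\<pi> s) (S - {s}) \<in> \<I>"
      "\<forall>s\<in>S. \<pi> s \<in> S \<longrightarrow> \<pi> s = s"
    using exchange_bijection[OF S T] by auto
  have "(\<Sum>s\<in>S. swap_gain \<phi> f S s (\<pi> s)) \<le> (\<Sum>s\<in>S. t)"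
  proof (intro sum_mono)
    fix s assume s: "s \<in> S"
    show "swap_gain \<phi> f S s (\<pi> s) \<le> t"
    proof (cases "\<pi> s = s")
      case True
      then show ?thesis using t by (simp add: swap_gain_def)
    next
      case False
      then have "\<pi> s \<in> X - S" using \<pi> s sub by (auto simp: bij_betw_def)
      then show ?thesis using opt s \<pi> by auto
    qed
  qed
  then have le: "(\<Sum>s\<in>S. swap_gain \<phi> f S s (\<pi> s)) \<le> real (matroid_rank \<I>) * t"
    by (simp add: k)
  have gain: "(\<Sum>s\<in>S. swap_gain \<phi> f S s (\<pi> s)) =
      (\<Sum>s\<in>S. \<Sum>B\<in>Pow (S - {s}). wt \<phi> (?k - 1) (card B) * (f (insert (\<pi> s) B) - f B)) -
      (\<Sum>s\<in>S. \<Sum>B\<in>Pow (S - {s}). wt \<phi> (?k - 1) (card B) * (f (insert s B) - f B))"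
    unfolding swap_gain_def by (simp add: algebra_simps flip: sum_subtractf)
  have marg: "(\<Sum>s\<in>S. \<Sum>B\<in>Pow (S - {s}). wt \<phi> (?k - 1) (card B) * (f (insert s B) - f B)) = f S - \<phi> * ?F"
    unfolding sum_wt_marginals[OF fin] by (simp add: f_empty)
  have exch: "(\<Sum>s\<in>S. \<Sum>B\<in>Pow (S - {s}). wt \<phi> (?k - 1) (card B) * (f (insert (\<pi> s) B) - f B)) =
      (\<Sum>s\<in>S. \<Sum>B\<in>Pow S. wt \<phi> ?k (card B) * (f (insert (\<pi> s) (B - {s})) - f (B - {s})))"
    by (intro sum.cong refl sum_wt_remove fin)
  also have "\<dots> = (\<Sum>B\<in>Pow S. wt \<phi> ?k (card B) * (\<Sum>s\<in>S. f (insert (\<pi> s) (B - {s})) - f (B - {s})))"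
    by (subst sum.swap) (simp add: sum_distrib_left)
  finally have exch: "(\<Sum>s\<in>S. \<Sum>B\<in>Pow (S - {s}). wt \<phi> (?k - 1) (card B) * (f (insert (\<pi> s) B) - f B)) = \<dots>" .
  have "rho \<phi> * (\<gamma>\<^sup>2 * f T) - \<phi> * ?F = (\<Sum>B\<in>Pow S. wt \<phi> ?k (card B) * (\<gamma>\<^sup>2 * f T - \<phi> * f B))"
  proof -
    have "(\<Sum>B\<in>Pow S. wt \<phi> ?k (card B) * (\<gamma>\<^sup>2 * f T)) = rho \<phi> * (\<gamma>\<^sup>2 * f T)"
      using sum_wt[OF fin, of \<phi>] \<open>0 < \<phi>\<close> by (simp flip: sum_distrib_right)
    then show ?thesis
      by (simp add: right_diff_distrib sum_subtractf sum_distrib_left mult.left_commute)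
  qed
  also have "\<dots> \<le> (\<Sum>B\<in>Pow S. wt \<phi> ?k (card B) * (\<Sum>s\<in>S. f (insert (\<pi> s) (B - {s})) - f (B - {s})))"
  proof (intro sum_mono mult_left_mono wt_nonneg)
    fix B assume B: "B \<in> Pow S"
    then have "0 \<le> f B" using sub by (intro f_nonneg) auto
    then have "phi \<gamma> \<beta> * f B \<le> \<phi> * f B" using \<phi> by (intro mult_right_mono)
    then show "\<gamma>\<^sup>2 * f T - \<phi> * f B \<le> (\<Sum>s\<in>S. f (insert (\<pi> s) (B - {s})) - f (B - {s}))"
      using exchange_marginals[OF sub \<pi>(1), of B] \<pi>(3) B by force
  qed
  finally show ?thesis using le unfolding gain marg exch by (simp add: mult.assoc)
qed

end

section \<open>Sampling and oracle queries\<close>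

definition random_subset :: "real \<Rightarrow> 'a set \<Rightarrow> 'a set pmf" where
  "random_subset \<phi> A = embed_pmf (\<lambda>B. if B \<subseteq> A then wt \<phi> (card A) (card B) / rho \<phi> else 0)"

text \<open>The distribution of a two-stage draw: p with density proportional to
  \<open>exp (\<phi> * (p - 1))\<close>, then every element independently with probability p.
  Integrating p out in advance keeps the draw discrete, as a \<open>pmf\<close> requires.\<close>

lemma pmf_random_subset:
  assumes "finite A" "0 < \<phi>"
  shows "pmf (random_subset \<phi> A) B = (if B \<subseteq> A then wt \<phi> (card A) (card B) / rho \<phi> else 0)"
  unfolding random_subset_def
proof (rule pmf_embed_pmf)
  let ?q = "\<lambda>B. if B \<subseteq> A then wt \<phi> (card A) (card B) / rho \<phi> else 0"
  show nn: "0 \<le> ?q B" for B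
    using wt_nonneg rho_pos[OF assms(2)] by simp
  have "(\<integral>\<^sup>+B. ennreal (?q B) \<partial>count_space UNIV) = (\<Sum>B\<in>Pow A. ennreal (?q B))"
    by (rule nn_integral_count_space') (use assms in auto)
  also have "\<dots> = ennreal (\<Sum>B\<in>Pow A. ?q B)"
    by (intro sum_ennreal nn)
  also have "(\<Sum>B\<in>Pow A. ?q B) = (\<Sum>B\<in>Pow A. wt \<phi> (card A) (card B)) / rho \<phi>"
    by (simp add: sum_divide_distrib)
  also have "\<dots> = 1"
    using sum_wt[OF assms(1), of \<phi>] rho_pos[OF assms(2)] assms(2) by simp
  finally show "(\<integral>\<^sup>+B. ennreal (?q B) \<partial>count_space UNIV) = 1" by simp
qed

lemma set_random_subset:
  assumes "finite A" "0 < \<phi>"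
  shows "set_pmf (random_subset \<phi> A) \<subseteq> Pow A"
  by (auto simp: set_pmf_iff pmf_random_subset[OF assms] split: if_splits)

lemma expectation_random_subset:
  assumes "finite A" "0 < \<phi>"
  shows "rho \<phi> * measure_pmf.expectation (random_subset \<phi> A) h =
    (\<Sum>B\<in>Pow A. wt \<phi> (card A) (card B) * h B)"
proof -
  have "measure_pmf.expectation (random_subset \<phi> A) h =
      (\<Sum>B\<in>Pow A. h B * pmf (random_subset \<phi> A) B)"
    by (rule integral_measure_pmf_real) (use set_random_subset[OF assms] assms in auto)
  also have "\<dots> = (\<Sum>B\<in>Pow A. wt \<phi> (card A) (card B) * h B) / rho \<phi>"
    unfolding sum_divide_distrib by (intro sum.cong refl) (simp add: pmf_random_subset[OF assms])
  finally show ?thesis using rho_pos[OF assms(2)] by simp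
qed

text \<open>The same subsets serve all candidates \<open>e\<close> for a given \<open>s\<close>; the
  resulting dependence is harmless because failures are combined by a union bound.\<close>

definition samples :: "real \<Rightarrow> nat \<Rightarrow> 'a set \<Rightarrow> ('a \<times> nat \<Rightarrow> 'a set) pmf" where
  "samples \<phi> m S = Pi_pmf (S \<times> {..<m}) {} (\<lambda>(s, i). random_subset \<phi> (S - {s}))"

definition estimate ::
    "real \<Rightarrow> nat \<Rightarrow> ('a set \<Rightarrow> real) \<Rightarrow> ('a \<times> nat \<Rightarrow> 'a set) \<Rightarrow> 'a \<Rightarrow> 'a \<Rightarrow> real" where
  "estimate \<phi> m h \<omega> s e =
     rho \<phi> * (\<Sum>i<m. h (insert e (\<omega> (s, i))) - h (insert s (\<omega> (s, i)))) / real m"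

lemma samples_subset:
  assumes "finite S" "0 < \<phi>" "\<omega> \<in> set_pmf (samples \<phi> m S)" "s \<in> S" "i < m"
  shows "\<omega> (s, i) \<subseteq> S - {s}"
proof -
  have "\<omega> \<in> PiE_dflt (S \<times> {..<m}) {} (set_pmf \<circ> (\<lambda>(s, i). random_subset \<phi> (S - {s})))"
    by (rule subsetD[OF set_Pi_pmf_subset']) (use assms in \<open>auto simp: samples_def\<close>)
  then have "\<omega> (s, i) \<in> set_pmf (random_subset \<phi> (S - {s}))"
    using assms(4,5) by (auto simp: PiE_dflt_def)
  then show ?thesis using set_random_subset[of "S - {s}" \<phi>] assms by auto
qed

text \<open>Hoeffding's inequality for \<open>m\<close> independent values in [-M, M], whose
  exponent is 2 (m \<tau>)^2 / (m (2 M)^2). The factor \<open>rho \<phi>\<close>, being at most 1,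
  only shrinks the deviation.\<close>

lemma estimate_concentration:
  assumes S: "finite S" "s \<in> S" and pos: "0 < \<phi>" "0 < m" "0 < M" "0 < \<tau>"
    and bound: "\<And>B. B \<subseteq> S - {s} \<Longrightarrow> \<bar>f (insert e B) - f (insert s B)\<bar> \<le> M"
  shows "measure_pmf.prob (samples \<phi> m S) {\<omega>. \<tau> \<le> \<bar>estimate \<phi> m f \<omega> s e - swap_gain \<phi> f S s e\<bar>}
    \<le> 2 * exp (- (real m * \<tau>\<^sup>2 / (2 * M\<^sup>2)))"
proof -
  define J where "J = {s} \<times> {..<m}"
  define g where "g B = f (insert e B) - f (insert s B)" for B
  define \<nu> where "\<nu> = measure_pmf.expectation (random_subset \<phi> (S - {s})) g"
  let ?P = "samples \<phi> m S"
  have finS: "finite (S \<times> {..<m})" "finite (S - {s})" "finite J" using S by (auto simp: J_def)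
  have J: "J \<subseteq> S \<times> {..<m}" "card J = m" using S by (auto simp: J_def)
  have mean: "measure_pmf.expectation ?P (\<lambda>\<omega>. g (\<omega> x)) = \<nu>" if "x \<in> J" for x
  proof -
    have "measure_pmf.expectation ?P (\<lambda>\<omega>. g (\<omega> x)) = measure_pmf.expectation (map_pmf (\<lambda>\<omega>. \<omega> x) ?P) g"
      by simp
    also have "map_pmf (\<lambda>\<omega>. \<omega> x) ?P = random_subset \<phi> (S - {s})"
      unfolding samples_def using that J by (subst Pi_pmf_component[OF finS(1)]) (auto simp: J_def)
    finally show ?thesis by (simp add: \<nu>_def)
  qed
  interpret Hoeffding_ineq "measure_pmf ?P" J "\<lambda>x \<omega>. g (\<omega> x)" "\<lambda>_. - M" "\<lambda>_. M"
    "\<Sum>x\<in>J. measure_pmf.expectation ?P (\<lambda>\<omega>. g (\<omega> x))"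
  proof unfold_locales
    have "prob_space.indep_vars (measure_pmf ?P) (\<lambda>_. count_space UNIV) (\<lambda>x \<omega>. \<omega> x) (S \<times> {..<m})"
      unfolding samples_def by (rule indep_vars_Pi_pmf[OF finS(1)])
    then have "prob_space.indep_vars (measure_pmf ?P) (\<lambda>_. count_space UNIV) (\<lambda>x \<omega>. \<omega> x) J"
      by (rule prob_space.indep_vars_subset[OF measure_pmf.prob_space_axioms]) (rule J)
    then show "prob_space.indep_vars (measure_pmf ?P) (\<lambda>_. borel) (\<lambda>x \<omega>. g (\<omega> x)) J"
      by (rule prob_space.indep_vars_compose2[OF measure_pmf.prob_space_axioms]) simp
    show "AE \<omega> in measure_pmf ?P. g (\<omega> x) \<in> {- M..M}" if "x \<in> J" for x
    proof (intro AE_pmfI)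
      fix \<omega> assume "\<omega> \<in> set_pmf ?P"
      then have "\<omega> x \<subseteq> S - {s}"
        using samples_subset[OF S(1) pos(1) _ S(2), of \<omega> m "snd x"] that by (auto simp: J_def)
      then show "g (\<omega> x) \<in> {- M..M}" using bound[of "\<omega> x"] by (auto simp: g_def abs_le_iff)
    qed
  qed (use finS in auto)
  have gain: "swap_gain \<phi> f S s e = rho \<phi> * \<nu>"
    unfolding \<nu>_def expectation_random_subset[OF finS(2) pos(1)] swap_gain_def g_def using S by simp
  have "real m * \<tau> \<le> \<bar>(\<Sum>x\<in>J. g (\<omega> x)) - real m * \<nu>\<bar>"
    if "\<tau> \<le> \<bar>estimate \<phi> m f \<omega> s e - swap_gain \<phi> f S s e\<bar>" for \<omega>
  proof -
    have J_sum: "(\<Sum>x\<in>J. g (\<omega> x)) = (\<Sum>i<m. g (\<omega> (s, i)))"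
    proof -
      have "J = Pair s ` {..<m}" by (auto simp: J_def)
      then show ?thesis by (simp add: sum.reindex inj_on_def)
    qed
    have "estimate \<phi> m f \<omega> s e - swap_gain \<phi> f S s e =
        rho \<phi> * ((\<Sum>x\<in>J. g (\<omega> x)) - real m * \<nu>) / real m"
      unfolding estimate_def gain J_sum unfolding g_def using pos by (simp add: field_simps)
    then have "\<bar>estimate \<phi> m f \<omega> s e - swap_gain \<phi> f S s e\<bar> =
        rho \<phi> * \<bar>(\<Sum>x\<in>J. g (\<omega> x)) - real m * \<nu>\<bar> / real m"
      using rho_pos[OF pos(1)] by (simp add: abs_mult)
    also have "\<dots> \<le> 1 * \<bar>(\<Sum>x\<in>J. g (\<omega> x)) - real m * \<nu>\<bar> / real m"
      using rho_le_1[OF pos(1)] by (intro divide_right_mono mult_right_mono) auto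
    finally have "\<tau> \<le> \<bar>(\<Sum>x\<in>J. g (\<omega> x)) - real m * \<nu>\<bar> / real m"
      using that by simp
    then show ?thesis using pos by (simp add: field_simps)
  qed
  then have "measure_pmf.prob ?P {\<omega>. \<tau> \<le> \<bar>estimate \<phi> m f \<omega> s e - swap_gain \<phi> f S s e\<bar>} \<le>
      measure_pmf.prob ?P {\<omega> \<in> space (measure_pmf ?P). real m * \<tau> \<le> \<bar>(\<Sum>x\<in>J. g (\<omega> x))
        - (\<Sum>x\<in>J. measure_pmf.expectation ?P (\<lambda>\<omega>. g (\<omega> x)))\<bar>}"
    by (intro measure_pmf.finite_measure_mono) (auto simp: mean J(2))
  also have "\<dots> \<le> 2 * exp (- 2 * (real m * \<tau>)\<^sup>2 / (\<Sum>x\<in>J. (M - - M)\<^sup>2))"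
    by (rule Hoeffding_ineq_abs_ge) (use pos J in auto)
  also have "- 2 * (real m * \<tau>)\<^sup>2 / (\<Sum>x\<in>J. (M - - M)\<^sup>2) = - (real m * \<tau>\<^sup>2 / (2 * M\<^sup>2))"
    using pos J by (simp add: field_simps power2_eq_square)
  finally show ?thesis .
qed

section \<open>Batches of queries, query counts and accumulation of failures\<close>

primrec ask_list ::
    "'a set list \<Rightarrow> ('a set \<Rightarrow> real) \<Rightarrow> (('a set \<Rightarrow> real) \<Rightarrow> 'a oracle_alg) \<Rightarrow> 'a oracle_alg" where
  "ask_list [] h c = c h"
| "ask_list (A # As) h c = Query A (\<lambda>r. ask_list As (h(A := r)) c)"

definition ask :: "'a set set \<Rightarrow> (('a set \<Rightarrow> real) \<Rightarrow> 'a oracle_alg) \<Rightarrow> 'a oracle_alg" where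
  "ask Q c = ask_list (SOME As. set As = Q \<and> distinct As) (\<lambda>_. 0) c"

text \<open>All that a continuation learns from a batch. The default 0 hides \<open>f\<close>
  outside \<open>Q\<close>, so a decision based on a set that was not queried cannot pass for one
  based on \<open>f\<close>.\<close>

definition answers :: "('a set \<Rightarrow> real) \<Rightarrow> 'a set set \<Rightarrow> 'a set \<Rightarrow> real" where
  "answers f Q = (\<lambda>A. if A \<in> Q then f A else 0)"

lemma exec_ask_list:
  "exec f (ask_list As h c) =
    map_pmf (\<lambda>(S, qs). (S, As @ qs)) (exec f (c (\<lambda>A. if A \<in> set As then f A else h A)))"
proof (induction As arbitrary: h)
  case Nil
  then show ?case by (simp add: case_prod_beta' )
next
  case (Cons A As)
  have "(\<lambda>B. if B \<in> set As then f B else (h(A := f A)) B) =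
      (\<lambda>B. if B \<in> set (A # As) then f B else h B)" by auto
  then show ?case by (simp add: Cons.IH map_pmf_comp case_prod_beta')
qed

lemma exec_ask:
  assumes "finite Q"
  shows "\<exists>As. set As = Q \<and> length As = card Q \<and>
    exec f (ask Q c) = map_pmf (\<lambda>(S, qs). (S, As @ qs)) (exec f (c (answers f Q)))"
proof -
  define As where "As = (SOME As. set As = Q \<and> distinct As)"
  have As: "set As = Q \<and> distinct As"
    unfolding As_def by (rule someI_ex) (use assms finite_distinct_list in auto)
  have "exec f (ask Q c) = map_pmf (\<lambda>(S, qs). (S, As @ qs)) (exec f (c (answers f Q)))"
    unfolding ask_def As_def[symmetric] exec_ask_list using As by (simp add: answers_def)
  then show ?thesis using As by (intro exI[of _ As]) (auto simp: distinct_card)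
qed

definition output_pmf :: "('a set \<Rightarrow> real) \<Rightarrow> 'a oracle_alg \<Rightarrow> 'a set pmf" where
  "output_pmf f a = map_pmf fst (exec f a)"

lemma output_pmf_Return [simp]: "output_pmf f (Return S) = return_pmf S"
  by (simp add: output_pmf_def)

lemma output_pmf_ask:
  assumes "finite Q"
  shows "output_pmf f (ask Q c) = output_pmf f (c (answers f Q))"
  using exec_ask[OF assms, of f c] by (auto simp: output_pmf_def map_pmf_comp case_prod_beta')

lemma exec_Sample_map:
  "exec f (Sample (map_pmf g P)) = bind_pmf P (\<lambda>\<omega>. exec f (g \<omega>))"
  by (simp add: map_pmf_comp bind_eq_join_pmf)

lemma output_pmf_Sample_map:
  "output_pmf f (Sample (map_pmf g P)) = bind_pmf P (\<lambda>\<omega>. output_pmf f (g \<omega>))"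
  unfolding output_pmf_def exec_Sample_map by (simp add: map_bind_pmf)

definition queries_le :: "'a set \<Rightarrow> ('a set \<Rightarrow> real) \<Rightarrow> 'a oracle_alg \<Rightarrow> nat \<Rightarrow> bool" where
  "queries_le X f a b \<longleftrightarrow> (\<forall>(S, qs)\<in>set_pmf (exec f a). set qs \<subseteq> Pow X \<and> length qs \<le> b)"

lemma queries_le_Return: "queries_le X f (Return S) b"
  by (simp add: queries_le_def)

lemma queries_le_ask:
  assumes "finite Q" "Q \<subseteq> Pow X" "card Q \<le> q" "queries_le X f (c (answers f Q)) b"
  shows "queries_le X f (ask Q c) (q + b)"
  using exec_ask[OF assms(1), of f c] assms(2-4) unfolding queries_le_def by fastforce

lemma queries_le_Sample_map:
  assumes "\<And>\<omega>. \<omega> \<in> set_pmf P \<Longrightarrow> queries_le X f (g \<omega>) b"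
  shows "queries_le X f (Sample (map_pmf g P)) b"
  using assms unfolding queries_le_def exec_Sample_map by fastforce

lemma prob_bind_pmf_ge:
  assumes "\<And>x. x \<in> set_pmf P \<Longrightarrow> x \<in> E \<Longrightarrow> q \<le> measure_pmf.prob (K x) A"
    and "1 - \<eta> \<le> measure_pmf.prob P E" "q \<le> 1" "0 \<le> \<eta>"
  shows "q - \<eta> \<le> measure_pmf.prob (bind_pmf P K) A"
proof (cases "0 \<le> q")
  case True
  have "ennreal (q * measure_pmf.prob P E) = (\<integral>\<^sup>+x. ennreal q * indicator E x \<partial>measure_pmf P)"
    using True by (simp add: ennreal_mult measure_pmf.emeasure_eq_measure nn_integral_cmult)
  also have "\<dots> \<le> (\<integral>\<^sup>+x. emeasure (measure_pmf (K x)) A \<partial>measure_pmf P)"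
    by (intro nn_integral_mono_AE AE_pmfI)
      (use assms(1) in \<open>auto simp: measure_pmf.emeasure_eq_measure split: split_indicator intro!: ennreal_leI\<close>)
  also have "\<dots> = ennreal (measure_pmf.prob (bind_pmf P K) A)"
    by (simp add: emeasure_bind_pmf flip: measure_pmf.emeasure_eq_measure)
  finally have "q * measure_pmf.prob P E \<le> measure_pmf.prob (bind_pmf P K) A" by simp
  moreover have "q * (1 - \<eta>) \<le> q * measure_pmf.prob P E"
    using assms True by (intro mult_left_mono)
  moreover have "q * \<eta> \<le> \<eta>" using assms by (intro mult_left_le_one_le True)
  ultimately show ?thesis by (simp add: algebra_simps)
next
  case False
  then have "q - \<eta> \<le> 0" using assms by linarith
  then show ?thesis by (rule order_trans) simp
qed

section \<open>The local search\<close>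

definition swaps :: "'a set \<Rightarrow> 'a set set \<Rightarrow> 'a set \<Rightarrow> ('a \<times> 'a) set" where
  "swaps X \<I> S = {(s, e). s \<in> S \<and> e \<in> X - S \<and> insert e (S - {s}) \<in> \<I>}"

text \<open>The third component runs through all of \<open>X\<close>, which contains
  \<open>S\<close>, so the sets \<open>insert s (\<omega> (s, i))\<close> are queried as
  well.\<close>

definition step_queries :: "'a set \<Rightarrow> nat \<Rightarrow> 'a set \<Rightarrow> ('a \<times> nat \<Rightarrow> 'a set) \<Rightarrow> 'a set set" where
  "step_queries X m S \<omega> = (\<lambda>(s, i, e). insert e (\<omega> (s, i))) ` (S \<times> {..<m} \<times> X)"

text \<open>The threshold 2\<tau> is matched to an error below \<tau>: an accepted exchange gains at
  least \<tau>, and if none is accepted, every exchange gains at most 3\<tau>.\<close>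

definition choose_swap :: "'a set \<Rightarrow> 'a set set \<Rightarrow> real \<Rightarrow> real \<Rightarrow> nat \<Rightarrow> 'a set \<Rightarrow>
    ('a set \<Rightarrow> real) \<Rightarrow> ('a \<times> nat \<Rightarrow> 'a set) \<Rightarrow> ('a \<times> 'a) option" where
  "choose_swap X \<I> \<phi> \<tau> m S h \<omega> =
     (let G = {(s, e) \<in> swaps X \<I> S. 2 * \<tau> \<le> estimate \<phi> m h \<omega> s e}
      in if G = {} then None else Some (SOME p. p \<in> G))"

text \<open>Each step draws fresh samples, so its error bound holds for any base reached
  before.\<close>

definition step :: "'a set \<Rightarrow> 'a set set \<Rightarrow> real \<Rightarrow> real \<Rightarrow> nat \<Rightarrow> 'a set \<Rightarrow>
    (('a \<times> 'a) option \<Rightarrow> 'a oracle_alg) \<Rightarrow> 'a oracle_alg" where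
  "step X \<I> \<phi> \<tau> m S c = Sample (map_pmf
     (\<lambda>\<omega>. ask (step_queries X m S \<omega>) (\<lambda>h. c (choose_swap X \<I> \<phi> \<tau> m S h \<omega>))) (samples \<phi> m S))"

text \<open>
  One run for a fixed accuracy \<open>\<tau>\<close>: \<open>S\<close> is the current base, \<open>1 / (j * \<epsilon>)\<close> the current
  guess for \<open>phi \<gamma> \<beta>\<close>, and \<open>H\<close> collects the bases that were locally optimal for some guess.
\<close>

primrec loop :: "'a set \<Rightarrow> 'a set set \<Rightarrow> real \<Rightarrow> real \<Rightarrow> nat \<Rightarrow>
    ('a set \<Rightarrow> 'a set list \<Rightarrow> 'a oracle_alg) \<Rightarrow> nat \<Rightarrow> 'a set \<Rightarrow> nat \<Rightarrow> 'a set list \<Rightarrow> 'a oracle_alg" where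
  "loop X \<I> \<epsilon> \<tau> m c 0 S j H = c S H"
| "loop X \<I> \<epsilon> \<tau> m c (Suc N) S j H = step X \<I> (1 / (real j * \<epsilon>)) \<tau> m S
     (\<lambda>r. case r of None \<Rightarrow> loop X \<I> \<epsilon> \<tau> m c N S (Suc j) (S # H)
        | Some (s, e) \<Rightarrow> loop X \<I> \<epsilon> \<tau> m c N (insert e (S - {s})) j H)"

definition return_best :: "'a set list \<Rightarrow> 'a oracle_alg" where
  "return_best H = ask (set H) (\<lambda>h. Return (SOME A. A \<in> set H \<and> (\<forall>B\<in>set H. h B \<le> h A)))"

text \<open>The list contains the guesses for the optimal value.\<close>

primrec scan :: "'a set \<Rightarrow> 'a set set \<Rightarrow> real \<Rightarrow> nat \<Rightarrow> nat \<Rightarrow> real list \<Rightarrow>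
    'a set \<Rightarrow> 'a set list \<Rightarrow> 'a oracle_alg" where
  "scan X \<I> \<epsilon> m N [] S H = return_best H"
| "scan X \<I> \<epsilon> m N (Z # Zs) S H =
     loop X \<I> \<epsilon> (\<epsilon> * Z / real (matroid_rank \<I>)) m (scan X \<I> \<epsilon> m N Zs) N S 1 H"

section \<open>Query counts and guarantees that hold without accurate estimates\<close>

context matroid
begin

lemma base_swap:
  assumes "base S" "(s, e) \<in> swaps X \<I> S"
  shows "base (insert e (S - {s}))"
proof -
  have "finite S" using assms finite_indep by (auto simp: base_def)
  then have "card (insert e (S - {s})) = card S"
    using assms(2) card_Suc_Diff1[of S s] by (auto simp: swaps_def)
  then show ?thesis using assms by (auto simp: base_def swaps_def)
qed

lemma base_props: "base S \<Longrightarrow> finite S" "base S \<Longrightarrow> S \<subseteq> X" "base S \<Longrightarrow> S \<in> \<I>"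
  using finite_indep indep_subset_ground by (auto simp: base_def)

lemma choose_swap_Some: "choose_swap X \<I> \<phi> \<tau> m S h \<omega> = Some p \<Longrightarrow>
    p \<in> {(s, e) \<in> swaps X \<I> S. 2 * \<tau> \<le> estimate \<phi> m h \<omega> s e}"
  unfolding choose_swap_def Let_def by (metis (no_types, lifting) all_not_in_conv option.distinct(1) option.inject someI)

lemma choose_swap_None: "choose_swap X \<I> \<phi> \<tau> m S h \<omega> = None \<Longrightarrow> (s, e) \<in> swaps X \<I> S \<Longrightarrow>
    estimate \<phi> m h \<omega> s e < 2 * \<tau>"
  unfolding choose_swap_def Let_def by (auto simp: not_le split: if_splits)

lemma step_queries:
  assumes "base S" "0 < \<phi>" "\<omega> \<in> set_pmf (samples \<phi> m S)"
  shows "finite (step_queries X m S \<omega>)" "step_queries X m S \<omega> \<subseteq> Pow X"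
    "card (step_queries X m S \<omega>) \<le> matroid_rank \<I> * m * card X"
proof -
  have S: "finite S" "S \<subseteq> X" "card S = matroid_rank \<I>"
    using base_props[OF assms(1)] assms(1) by (auto simp: base_def)
  then show "finite (step_queries X m S \<omega>)"
    using finite_ground by (simp add: step_queries_def)
  show "step_queries X m S \<omega> \<subseteq> Pow X"
    using samples_subset[OF S(1) assms(2,3)] S(2) unfolding step_queries_def by fast
  have "card (step_queries X m S \<omega>) \<le> card (S \<times> {..<m} \<times> X)"
    unfolding step_queries_def by (rule card_image_le) (use S finite_ground in auto)
  then show "card (step_queries X m S \<omega>) \<le> matroid_rank \<I> * m * card X"
    using S by (simp add: card_cartesian_product mult.assoc)
qed

lemma estimate_answers:
  assumes "base S" "(s, e) \<in> swaps X \<I> S"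
  shows "estimate \<phi> m (answers f (step_queries X m S \<omega>)) \<omega> s e = estimate \<phi> m f \<omega> s e"
proof -
  have "insert x (\<omega> (s, i)) \<in> step_queries X m S \<omega>" if "x \<in> {s, e}" "i < m" for x i
  proof -
    have "(s, i, x) \<in> S \<times> {..<m} \<times> X" using that assms base_props(2)[OF assms(1)] by (auto simp: swaps_def)
    then show ?thesis unfolding step_queries_def by (rule rev_image_eqI) simp
  qed
  then show ?thesis by (simp add: estimate_def answers_def)
qed

lemma queries_le_step:
  assumes "base S" "0 < \<phi>" "queries_le X f (c None) b"
    and "\<And>s e. (s, e) \<in> swaps X \<I> S \<Longrightarrow> queries_le X f (c (Some (s, e))) b"
  shows "queries_le X f (step X \<I> \<phi> \<tau> m S c) (matroid_rank \<I> * m * card X + b)"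
  unfolding step_def
proof (intro queries_le_Sample_map queries_le_ask)
  fix \<omega> assume "\<omega> \<in> set_pmf (samples \<phi> m S)"
  note step_queries[OF assms(1,2) this]
  then show "finite (step_queries X m S \<omega>)" "step_queries X m S \<omega> \<subseteq> Pow X"
    "card (step_queries X m S \<omega>) \<le> matroid_rank \<I> * m * card X" .
  let ?h = "answers f (step_queries X m S \<omega>)"
  show "queries_le X f (c (choose_swap X \<I> \<phi> \<tau> m S ?h \<omega>)) b"
  proof (cases "choose_swap X \<I> \<phi> \<tau> m S ?h \<omega>")
    case None
    then show ?thesis using assms by simp
  next
    case (Some p)
    then show ?thesis using assms(4) choose_swap_Some[OF Some] by auto
  qed
qed

lemma queries_le_loop:
  assumes "\<And>S H'. base S \<Longrightarrow> set H' \<subseteq> \<I> \<Longrightarrow> length H' \<le> length H + N \<Longrightarrow> queries_le X f (c S H') b"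
    and "base S" "set H \<subseteq> \<I>" "0 < j" "0 < \<epsilon>"
  shows "queries_le X f (loop X \<I> \<epsilon> \<tau> m c N S j H) (N * (matroid_rank \<I> * m * card X) + b)"
  using assms
proof (induction N arbitrary: S j H)
  case (Suc N)
  let ?r = "matroid_rank \<I> * m * card X"
  have "queries_le X f (loop X \<I> \<epsilon> \<tau> m c (Suc N) S j H) (?r + (N * ?r + b))"
    unfolding loop.simps
  proof (rule queries_le_step)
    show "queries_le X f (case None of None \<Rightarrow> loop X \<I> \<epsilon> \<tau> m c N S (Suc j) (S # H)
        | Some (s, e) \<Rightarrow> loop X \<I> \<epsilon> \<tau> m c N (insert e (S - {s})) j H) (N * ?r + b)"
      using Suc.prems base_props(3)[OF Suc.prems(2)] by (simp, intro Suc.IH) auto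
    show "queries_le X f (case Some (s, e) of None \<Rightarrow> loop X \<I> \<epsilon> \<tau> m c N S (Suc j) (S # H)
        | Some (s, e) \<Rightarrow> loop X \<I> \<epsilon> \<tau> m c N (insert e (S - {s})) j H) (N * ?r + b)"
      if "(s, e) \<in> swaps X \<I> S" for s e
      using Suc.prems base_swap[OF _ that] by (simp, intro Suc.IH) auto
  qed (use Suc.prems in auto)
  then show ?case by (simp add: algebra_simps)
qed simp

text \<open>The last summand pays for the final comparison: each step records at most one
  base.\<close>

lemma queries_le_scan:
  assumes "base S" "set H \<subseteq> \<I>" "0 < \<epsilon>"
  shows "queries_le X f (scan X \<I> \<epsilon> m N Zs S H)
    (length Zs * (N * (matroid_rank \<I> * m * card X)) + (length H + length Zs * N))"
  using assms
proof (induction Zs arbitrary: S H)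
  case Nil
  have "queries_le X f (return_best H) (length H + 0)"
    unfolding return_best_def
    by (intro queries_le_ask queries_le_Return) (use Nil indep_subset_ground card_length in auto)
  then show ?case by simp
next
  case (Cons Z Zs)
  let ?r = "N * (matroid_rank \<I> * m * card X)"
  have "queries_le X f (scan X \<I> \<epsilon> m N (Z # Zs) S H)
      (?r + (length Zs * ?r + (length H + N + length Zs * N)))"
    unfolding scan.simps
  proof (rule queries_le_loop)
    fix S' H' assume *: "base S'" "set H' \<subseteq> \<I>" "length H' \<le> length H + N"
    have "queries_le X f (scan X \<I> \<epsilon> m N Zs S' H') (length Zs * ?r + (length H' + length Zs * N))"
      using * Cons.prems by (intro Cons.IH)
    then show "queries_le X f (scan X \<I> \<epsilon> m N Zs S' H') (length Zs * ?r + (length H + N + length Zs * N))"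
      using *(3) unfolding queries_le_def by fastforce
  qed (use Cons.prems in auto)
  then show ?case by (simp add: algebra_simps)
qed

lemma prob_step_ge:
  assumes "base S" "0 < \<phi>" "q \<le> 1" "0 \<le> \<eta>" "1 - \<eta> \<le> measure_pmf.prob (samples \<phi> m S) G"
    and None: "\<And>\<omega>. \<omega> \<in> G \<Longrightarrow> (\<And>s e. (s, e) \<in> swaps X \<I> S \<Longrightarrow> estimate \<phi> m f \<omega> s e < 2 * \<tau>) \<Longrightarrow>
      q \<le> measure_pmf.prob (output_pmf f (c None)) A"
    and Some: "\<And>\<omega> s e. \<omega> \<in> G \<Longrightarrow> (s, e) \<in> swaps X \<I> S \<Longrightarrow> 2 * \<tau> \<le> estimate \<phi> m f \<omega> s e \<Longrightarrow>
      q \<le> measure_pmf.prob (output_pmf f (c (Some (s, e)))) A"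
  shows "q - \<eta> \<le> measure_pmf.prob (output_pmf f (step X \<I> \<phi> \<tau> m S c)) A"
  unfolding step_def output_pmf_Sample_map
proof (rule prob_bind_pmf_ge[OF _ assms(5,3,4)])
  fix \<omega> assume \<omega>: "\<omega> \<in> set_pmf (samples \<phi> m S)" "\<omega> \<in> G"
  let ?h = "answers f (step_queries X m S \<omega>)"
  have "q \<le> measure_pmf.prob (output_pmf f (c (choose_swap X \<I> \<phi> \<tau> m S ?h \<omega>))) A"
  proof (cases "choose_swap X \<I> \<phi> \<tau> m S ?h \<omega>")
    case N: None
    show ?thesis unfolding N
      using choose_swap_None[OF N] estimate_answers[OF assms(1)] by (intro None[OF \<omega>(2)]) metis
  next
    case S: (Some p)
    obtain s e where p: "p = (s, e)" by (cases p)
    have "(s, e) \<in> swaps X \<I> S" "2 * \<tau> \<le> estimate \<phi> m ?h \<omega> s e"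
      using choose_swap_Some[OF S] p by auto
    then show ?thesis unfolding S p
      using estimate_answers[OF assms(1)] by (intro Some[OF \<omega>(2)]) auto
  qed
  then show "q \<le> measure_pmf.prob (output_pmf f (ask (step_queries X m S \<omega>)
      (\<lambda>h. c (choose_swap X \<I> \<phi> \<tau> m S h \<omega>)))) A"
    using step_queries(1)[OF assms(1,2) \<omega>(1)] by (simp add: output_pmf_ask)
qed

text \<open>Choosing the full event with \<eta> = 0 makes every step count as accurate. This handles
  runs at a wrong scale and all steps after a success without adding to the failure
  probability.\<close>

lemma prob_loop_invariant:
  assumes c: "\<And>S H. base S \<Longrightarrow> Q H \<Longrightarrow> q \<le> measure_pmf.prob (output_pmf f (c S H)) A"
    and Q: "\<And>S H. base S \<Longrightarrow> Q H \<Longrightarrow> Q (S # H)"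
    and "base S" "Q H" "0 < j" "0 < \<epsilon>" "q \<le> 1"
  shows "q \<le> measure_pmf.prob (output_pmf f (loop X \<I> \<epsilon> \<tau> m c N S j H)) A"
  using assms(3-5)
proof (induction N arbitrary: S j H)
  case 0
  then show ?case using c by simp
next
  case (Suc N)
  have "q - 0 \<le> measure_pmf.prob (output_pmf f (loop X \<I> \<epsilon> \<tau> m c (Suc N) S j H)) A"
    unfolding loop.simps
    by (rule prob_step_ge[where G = UNIV])
      (use Suc assms(6,7) base_swap Q in \<open>auto simp: measure_pmf.prob_space[simplified]\<close>)
  then show ?case by simp
qed

end

section \<open>Progress of a run with accurate estimates\<close>

context weakly_submodular_matroid
begin

text \<open>A union bound over at most k n exchanges. Only independent sets are evaluated in them,
  so all values lie in [0, M] and their differences in [-M, M].\<close>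

lemma estimates_accurate:
  assumes "base S" and pos: "0 < \<phi>" "0 < m" "0 < M" "0 < \<tau>" and M: "\<And>A. A \<in> \<I> \<Longrightarrow> f A \<le> M"
  shows "1 - real (matroid_rank \<I> * card X) * (2 * exp (- (real m * \<tau>\<^sup>2 / (2 * M\<^sup>2)))) \<le>
    measure_pmf.prob (samples \<phi> m S)
      {\<omega>. \<forall>(s, e)\<in>swaps X \<I> S. \<bar>estimate \<phi> m f \<omega> s e - swap_gain \<phi> f S s e\<bar> < \<tau>}"
    (is "1 - _ * ?\<eta> \<le> measure_pmf.prob ?P ?G")
proof -
  let ?bad = "\<lambda>(s, e). {\<omega>. \<tau> \<le> \<bar>estimate \<phi> m f \<omega> s e - swap_gain \<phi> f S s e\<bar>}"
  have S: "finite S" "S \<subseteq> X" "card S = matroid_rank \<I>"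
    using base_props[OF assms(1)] assms(1) by (auto simp: base_def)
  have sub: "swaps X \<I> S \<subseteq> S \<times> X" by (auto simp: swaps_def)
  then have fin: "finite (swaps X \<I> S)" using S finite_ground by (meson finite_SigmaI finite_subset)
  have "card (swaps X \<I> S) \<le> card (S \<times> X)" using sub S finite_ground by (intro card_mono) auto
  then have card: "card (swaps X \<I> S) \<le> matroid_rank \<I> * card X"
    using S by (simp add: card_cartesian_product)
  have "measure_pmf.prob ?P (\<Union>p\<in>swaps X \<I> S. ?bad p) \<le> (\<Sum>p\<in>swaps X \<I> S. measure_pmf.prob ?P (?bad p))"
    by (rule measure_pmf.finite_measure_subadditive_finite) (use fin in auto)
  also have "\<dots> \<le> (\<Sum>p\<in>swaps X \<I> S. ?\<eta>)"
  proof (intro sum_mono)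
    fix p assume p: "p \<in> swaps X \<I> S"
    obtain s e where se: "p = (s, e)" by (cases p)
    have s: "s \<in> S" "e \<in> X" "insert e (S - {s}) \<in> \<I>" using p se by (auto simp: swaps_def)
    have "\<bar>f (insert e B) - f (insert s B)\<bar> \<le> M" if B: "B \<subseteq> S - {s}" for B
    proof -
      have "insert e B \<in> \<I>" using s(3) by (rule indep_mono) (use B in auto)
      moreover have "insert s B \<in> \<I>" using base_props(3)[OF assms(1)] by (rule indep_mono) (use B s in auto)
      ultimately have "f (insert e B) \<le> M" "f (insert s B) \<le> M" "0 \<le> f (insert e B)" "0 \<le> f (insert s B)"
        using M f_nonneg indep_subset_ground by auto
      then show ?thesis by linarith
    qed
    then show "measure_pmf.prob ?P (?bad p) \<le> ?\<eta>"
      using estimate_concentration[OF S(1) s(1) pos, of f e] se by simp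
  qed
  also have "\<dots> \<le> real (matroid_rank \<I> * card X) * ?\<eta>"
    unfolding sum_constant using card by (intro mult_right_mono) (auto simp del: of_nat_mult)
  finally have "measure_pmf.prob ?P (\<Union>p\<in>swaps X \<I> S. ?bad p) \<le> real (matroid_rank \<I> * card X) * ?\<eta>" .
  moreover have "?G = UNIV - (\<Union>p\<in>swaps X \<I> S. ?bad p)" by (auto simp: not_le)
  then have "measure_pmf.prob ?P ?G = 1 - measure_pmf.prob ?P (\<Union>p\<in>swaps X \<I> S. ?bad p)"
    using measure_pmf.prob_compl[of "\<Union>p\<in>swaps X \<I> S. ?bad p" ?P] by simp
  ultimately show ?thesis by linarith
qed

text \<open>
  The left-hand side of the last assumption is a bound on the number of accurate steps that are left before
  the search finishes the guess \<open>jstar\<close>: each such step advances \<open>j\<close> or increases the potential by \<open>\<tau>\<close>.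
\<close>

lemma prob_loop_reaches:
  fixes jstar :: nat
  assumes c: "\<And>S H. base S \<Longrightarrow> set H \<subseteq> \<I> \<Longrightarrow> \<exists>A\<in>set H. P A \<Longrightarrow> q \<le> measure_pmf.prob (output_pmf f (c S H)) E"
    and P: "\<And>S. base S \<Longrightarrow> (\<And>s e. (s, e) \<in> swaps X \<I> S \<Longrightarrow>
       swap_gain (1 / (real jstar * \<epsilon>)) f S s e \<le> 3 * \<tau>) \<Longrightarrow> P S"
    and pos: "0 < m" "0 < M" "0 < \<tau>" "0 < \<epsilon>" and M: "\<And>A. A \<in> \<I> \<Longrightarrow> f A \<le> M" and q: "q \<le> 1"
    and \<eta>: "\<eta> = real (matroid_rank \<I> * card X) * (2 * exp (- (real m * \<tau>\<^sup>2 / (2 * M\<^sup>2))))"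
    and S: "base S" "set H \<subseteq> \<I>" "0 < j" "j \<le> jstar"
    and N: "real jstar - real j + (harm (matroid_rank \<I>) * M - potential (1 / (real j * \<epsilon>)) f S) / \<tau> \<le> real N - 1"
  shows "q - real N * \<eta> \<le> measure_pmf.prob (output_pmf f (loop X \<I> \<epsilon> \<tau> m c N S j H)) E"
  using S N
proof (induction N arbitrary: S j H)
  case 0
  \<comment> \<open>The budget would have to be at most -1 here, but the harmonic bound on the
    potential and \<open>j \<le> jstar\<close> make it nonnegative.\<close>
  have "potential (1 / (real j * \<epsilon>)) f S \<le> harm (card S) * M"
    using 0 base_props[OF 0(1)] pos M by (intro potential_le_harm) (auto intro: indep_mono)
  then have "0 \<le> (harm (matroid_rank \<I>) * M - potential (1 / (real j * \<epsilon>)) f S) / \<tau>"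
    using pos 0(1) by (simp add: base_def)
  then show ?case using 0 by simp
next
  case (Suc N)
  let ?\<phi> = "1 / (real j * \<epsilon>)"
  let ?G = "{\<omega>. \<forall>(s, e)\<in>swaps X \<I> S. \<bar>estimate ?\<phi> m f \<omega> s e - swap_gain ?\<phi> f S s e\<bar> < \<tau>}"
  have \<phi>: "0 < ?\<phi>" using Suc.prems pos by simp
  have "0 \<le> \<eta>" unfolding \<eta> by simp
  have nn: "\<And>B. B \<subseteq> S \<Longrightarrow> 0 \<le> f B" using base_props(2)[OF Suc.prems(1)] f_nonneg by auto
  have "(q - real N * \<eta>) - \<eta> \<le> measure_pmf.prob (output_pmf f (loop X \<I> \<epsilon> \<tau> m c (Suc N) S j H)) E"
    unfolding loop.simps
  proof (rule prob_step_ge[where G = ?G])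
    show "1 - \<eta> \<le> measure_pmf.prob (samples ?\<phi> m S) ?G"
      unfolding \<eta> by (rule estimates_accurate[OF Suc.prems(1) \<phi> pos(1-3) M])
    show "q - real N * \<eta> \<le> 1" using q \<open>0 \<le> \<eta>\<close> by (smt (verit) mult_nonneg_nonneg of_nat_0_le_iff)
  next
    fix \<omega> assume \<omega>: "\<omega> \<in> ?G" and small: "\<And>s e. (s, e) \<in> swaps X \<I> S \<Longrightarrow> estimate ?\<phi> m f \<omega> s e < 2 * \<tau>"
    have gain: "swap_gain ?\<phi> f S s e \<le> 3 * \<tau>" if "(s, e) \<in> swaps X \<I> S" for s e
      using \<omega> small[OF that] that by fastforce
    show "q - real N * \<eta> \<le> measure_pmf.prob (output_pmf f (case None of
        None \<Rightarrow> loop X \<I> \<epsilon> \<tau> m c N S (Suc j) (S # H)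
        | Some (s, e) \<Rightarrow> loop X \<I> \<epsilon> \<tau> m c N (insert e (S - {s})) j H)) E"
    proof (cases "j = jstar")
      case True
      then have "P S" using P Suc.prems gain by auto
      \<comment> \<open>The goal is reached: \<open>S\<close> is recorded, and no later step,
        accurate or not, removes it from the list.\<close>
      have "q \<le> measure_pmf.prob (output_pmf f (loop X \<I> \<epsilon> \<tau> m c N S (Suc j) (S # H))) E"
        by (rule prob_loop_invariant[where Q = "\<lambda>H. set H \<subseteq> \<I> \<and> (\<exists>A\<in>set H. P A)"])
          (use c Suc.prems base_props(3) \<open>P S\<close> pos q in auto)
      moreover have "0 \<le> real N * \<eta>" using \<open>0 \<le> \<eta>\<close> by simp
      ultimately show ?thesis by simp
    next
      case False
      \<comment> \<open>The next guess is smaller, so the potential of the same base can only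
        increase; the budget falls by 1 through \<open>j\<close>.\<close>
      have "1 / (real (Suc j) * \<epsilon>) \<le> ?\<phi>"
        using Suc.prems pos by (intro divide_left_mono mult_right_mono) auto
      then have "potential ?\<phi> f S \<le> potential (1 / (real (Suc j) * \<epsilon>)) f S"
        using nn by (rule potential_antimono)
      then have "(harm (matroid_rank \<I>) * M - potential (1 / (real (Suc j) * \<epsilon>)) f S) / \<tau> \<le>
          (harm (matroid_rank \<I>) * M - potential ?\<phi> f S) / \<tau>"
        using pos by (intro divide_right_mono) auto
      then have "real jstar - real (Suc j) +
          (harm (matroid_rank \<I>) * M - potential (1 / (real (Suc j) * \<epsilon>)) f S) / \<tau> \<le> real N - 1"
        using Suc.prems(5) by simp
      then have "q - real N * \<eta> \<le> measure_pmf.prob (output_pmf f (loop X \<I> \<epsilon> \<tau> m c N S (Suc j) (S # H))) E"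
        using Suc.prems False base_props(3)[OF Suc.prems(1)] by (intro Suc.IH) auto
      then show ?thesis by simp
    qed
  next
    fix \<omega> s e assume \<omega>: "\<omega> \<in> ?G" and se: "(s, e) \<in> swaps X \<I> S" and "2 * \<tau> \<le> estimate ?\<phi> m f \<omega> s e"
    then have gain: "\<tau> \<le> swap_gain ?\<phi> f S s e" by fastforce
    let ?S = "insert e (S - {s})"
    have "potential ?\<phi> f ?S = potential ?\<phi> f S + swap_gain ?\<phi> f S s e"
      using se base_props[OF Suc.prems(1)] by (intro potential_swap) (auto simp: swaps_def)
    then have "(harm (matroid_rank \<I>) * M - potential ?\<phi> f ?S) / \<tau> \<le>
        (harm (matroid_rank \<I>) * M - potential ?\<phi> f S - \<tau>) / \<tau>"
      using pos gain by (intro divide_right_mono) auto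
    also have "\<dots> = (harm (matroid_rank \<I>) * M - potential ?\<phi> f S) / \<tau> - 1"
      using pos by (simp add: field_simps)
    finally have "real jstar - real j + (harm (matroid_rank \<I>) * M - potential ?\<phi> f ?S) / \<tau> \<le> real N - 1"
      using Suc.prems(5) by simp
    then have "q - real N * \<eta> \<le> measure_pmf.prob (output_pmf f (loop X \<I> \<epsilon> \<tau> m c N ?S j H)) E"
      using Suc.prems base_swap[OF _ se] by (intro Suc.IH) auto
    then show "q - real N * \<eta> \<le> measure_pmf.prob (output_pmf f (case Some (s, e) of
        None \<Rightarrow> loop X \<I> \<epsilon> \<tau> m c N S (Suc j) (S # H)
        | Some (s, e) \<Rightarrow> loop X \<I> \<epsilon> \<tau> m c N (insert e (S - {s})) j H)) E"
      by simp
  qed (use Suc.prems \<phi> \<open>0 \<le> \<eta>\<close> in auto)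
  then show ?case by (simp add: algebra_simps)
qed

end

section \<open>Parameters and the approximation guarantee\<close>

text \<open>At most 2/\<epsilon> guesses, plus H_k M / \<tau> improving exchanges with M = 2Z and
  \<tau> = \<epsilon> Z / k for the right scale Z.\<close>

definition num_steps :: "nat \<Rightarrow> real \<Rightarrow> nat" where
  "num_steps k \<epsilon> = nat \<lceil>2 / \<epsilon> + 2 * real k * harm k / \<epsilon>\<rceil>"

text \<open>The factor 8 (k/\<epsilon>)^2 is 2 M^2 / \<tau>^2 for the same M and \<tau>. The
  argument of the logarithm makes the failures of k n exchanges in each of the steps add up to at
  most 1/n.\<close>

definition num_samples :: "nat \<Rightarrow> nat \<Rightarrow> real \<Rightarrow> nat" where
  "num_samples n k \<epsilon> =
     nat \<lceil>8 * (real k / \<epsilon>)\<^sup>2 * ln (2 * real k * (real n)\<^sup>2 * real (num_steps k \<epsilon>))\<rceil>"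

text \<open>The number of doublings from the best singleton value to the optimum, which is at most
  k/\<gamma> times as large, and so at most k/\<epsilon> times if \<epsilon> \<le> \<gamma>.\<close>

definition num_scales :: "nat \<Rightarrow> real \<Rightarrow> nat" where
  "num_scales k \<epsilon> = Suc (nat \<lfloor>log 2 (real k / \<epsilon>)\<rfloor>)"

text \<open>For \<epsilon> \<ge> 1 or rank 0 the empty set already satisfies the guarantee. Starting
  the record with \<open>[S]\<close> ensures that the final comparison has a candidate.\<close>

definition local_search :: "'a set \<Rightarrow> 'a set set \<Rightarrow> real \<Rightarrow> 'a oracle_alg" where
  "local_search X \<I> \<epsilon> =
    (let k = matroid_rank \<I>; n = card X; Q = (\<lambda>e. {e}) ` X \<inter> \<I>; S = (SOME S. S \<in> \<I> \<and> card S = k)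
     in if 1 \<le> \<epsilon> \<or> k = 0 then Return {}
        else ask Q (\<lambda>h. scan X \<I> \<epsilon> (num_samples n k \<epsilon>) (num_steps k \<epsilon>)
               (map (\<lambda>i. Max (h ` Q) * 2 ^ i) [0..<num_scales k \<epsilon>]) S [S]))"

text \<open>With x = k/\<epsilon> and up to logarithms: x steps, x^2 samples for each of k elements,
  and n candidates, in total n k x^3 = T. The constant is 1365 + 21 + 1 + 1: the search with 1365 =
  3 * 7 * 65, the recorded bases, the singletons and the initial base.\<close>

lemma query_budget:
  fixes n k :: nat and \<epsilon> :: real
  assumes "0 < \<epsilon>" "\<epsilon> < 1" "0 < k" "0 < n"
  defines "T \<equiv> real n * real k ^ 4 / \<epsilon> ^ 3"
  shows "real (n + (num_scales k \<epsilon> * (num_steps k \<epsilon> * (k * num_samples n k \<epsilon> * n)) +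
      (1 + num_scales k \<epsilon> * num_steps k \<epsilon>))) \<le> 1388 * T * ln (2 + T) ^ 3"
proof -
  define x where "x = real k / \<epsilon>"
  define \<Lambda> where "\<Lambda> = ln (2 + T)"
  define N where "N = num_steps k \<epsilon>"
  define m where "m = num_samples n k \<epsilon>"
  define L where "L = num_scales k \<epsilon>"
  have nk: "1 \<le> real n" "1 \<le> real k" using assms by auto
  have \<epsilon>x: "1 / \<epsilon> \<le> x" using assms nk by (simp add: x_def divide_right_mono)
  have x1: "1 \<le> x" using \<epsilon>x assms by (smt (verit) le_divide_eq_1)
  have kx: "real k \<le> x" using assms mult_left_mono[of \<epsilon> 1 "real k"] by (simp add: x_def field_simps)
  have Tx: "T = real n * real k * x ^ 3" by (simp add: T_def x_def field_simps power_numeral_reduce)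
  have x3: "x \<le> x ^ 3" "1 \<le> x ^ 3" using x1 power_increasing[of 1 3 x] by auto
  have one_le: "a \<le> a * b" if "1 \<le> b" "0 \<le> a" for a b :: real using that mult_left_mono[of 1 b a] by simp
  have nk_T: "real n * real k \<le> T" unfolding Tx using nk x3 by (intro one_le) auto
  have nT: "real n \<le> T" using one_le[of "real k" "real n"] nk nk_T by linarith
  have T1: "1 \<le> T" using nT nk by linarith
  have nk1: "1 \<le> real n * real k" using nk mult_mono[of 1 "real n" 1 "real k"] by simp
  have "x ^ 3 \<le> T" unfolding Tx using one_le[OF nk1, of "x ^ 3"] x1 x3 by (simp add: mult.commute)
  then have xT: "x \<le> T" using x3 by linarith
  have kT: "real k \<le> T" using kx xT by linarith
  have \<Lambda>1: "1 \<le> \<Lambda>"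
  proof -
    have "ln (exp 1 :: real) \<le> ln (2 + T)" using exp_le T1 by (subst ln_le_cancel_iff) auto
    then show ?thesis by (simp add: \<Lambda>_def)
  qed
  have ln_le: "ln y \<le> \<Lambda>" if "0 < y" "y \<le> T" for y
    unfolding \<Lambda>_def using that by simp
  have "harm k - ln (real k) \<le> harm 1 - ln (real 1)"
    using euler_mascheroni_sequence_decreasing[of 1 k] assms by simp
  then have harm: "harm k \<le> 2 * \<Lambda>" using ln_le[of "real k"] kT nk \<Lambda>1 by (simp add: harm_def)
  have harm0: "0 \<le> (harm k :: real)" by (simp add: harm_nonneg)
  have L: "real L \<le> 3 * \<Lambda>"
  proof -
    have "0 \<le> log 2 x" using x1 by simp
    then have "real L \<le> log 2 x + 1" by (simp add: L_def num_scales_def flip: x_def)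
    also have "log 2 x \<le> 2 * ln x"
    proof -
      have "1 / 2 \<le> ln (2::real)" using ln2_ge_two_thirds by simp
      then have "ln x * 1 \<le> ln x * (2 * ln 2)" using x1 by (intro mult_left_mono) auto
      then show ?thesis by (simp add: log_def field_simps)
    qed
    finally show ?thesis using ln_le[of x] xT x1 \<Lambda>1 by simp
  qed
  have N: "real N \<le> 7 * x * \<Lambda>"
  proof -
    have "0 \<le> 2 / \<epsilon> + 2 * real k * harm k / \<epsilon>" using assms harm0 by simp
    then have "real N \<le> 2 / \<epsilon> + 2 * real k * harm k / \<epsilon> + 1"
      unfolding N_def num_steps_def by linarith
    also have "\<dots> = 2 * (1 / \<epsilon>) + 2 * x * harm k + 1" by (simp add: x_def)
    also have "\<dots> \<le> 2 * (x * \<Lambda>) + 2 * x * (2 * \<Lambda>) + x * \<Lambda>"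
      using \<epsilon>x one_le[of \<Lambda> x] x1 \<Lambda>1 harm by (intro add_mono mult_left_mono) linarith+
    finally show ?thesis by (simp add: mult_ac)
  qed
  have N2: "2 \<le> real N"
  proof -
    have "2 \<le> 2 / \<epsilon>" using assms by (simp add: field_simps)
    moreover have "0 \<le> 2 * real k * harm k / \<epsilon>" using assms harm0 by simp
    ultimately show ?thesis unfolding N_def num_steps_def by linarith
  qed
  define U where "U = 2 + T"
  have U: "3 \<le> U" "real k \<le> U" "real n \<le> U" "x \<le> U" "\<Lambda> \<le> U" "ln U = \<Lambda>"
    using T1 kT nT xT ln_bound[of "2 + T"] by (auto simp: U_def \<Lambda>_def)
  have m: "real m \<le> 65 * x\<^sup>2 * \<Lambda>"
  proof -
    let ?y = "2 * real k * (real n)\<^sup>2 * real N"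
    \<comment> \<open>Since 7 \<le> 9 \<le> U^2, the step bound is below U^4 and the whole argument
      below U^8. Its logarithm is thus at most 8 \<Lambda>, and 65 = 8 * 8 + 1 with the 1 from
      rounding up.\<close>
    have "?y \<le> U * U * U\<^sup>2 * (U\<^sup>2 * U * U)"
    proof (intro mult_mono power_mono)
      have "3\<^sup>2 \<le> U\<^sup>2" using U by (intro power_mono) auto
      then have "7 * x * \<Lambda> \<le> U\<^sup>2 * U * U" using U x1 \<Lambda>1 by (intro mult_mono) auto
      then show "real N \<le> U\<^sup>2 * U * U" using N by linarith
    qed (use U in auto)
    also have "\<dots> = U ^ 8" by (simp add: power_numeral_reduce)
    finally have y: "?y \<le> U ^ 8" .
    have "2 * 1 * 1\<^sup>2 * 1 \<le> ?y" using nk N2 by (intro mult_mono power_mono) auto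
    then have y1: "1 \<le> ?y" by simp
    have "0 < ?y" "0 < U ^ 8" using y y1 by linarith+
    then have "ln ?y \<le> ln (U ^ 8)" using y by (simp only: ln_le_cancel_iff)
    also have "\<dots> = 8 * \<Lambda>" using U by (simp add: ln_realpow)
    finally have ly: "ln ?y \<le> 8 * \<Lambda>" .
    have "0 \<le> 8 * x\<^sup>2 * ln ?y" using y1 by simp
    then have "real m \<le> 8 * x\<^sup>2 * ln ?y + 1"
      unfolding m_def num_samples_def x_def[symmetric] N_def[symmetric] by linarith
    also have "\<dots> \<le> 8 * x\<^sup>2 * (8 * \<Lambda>) + x\<^sup>2 * \<Lambda>"
    proof (intro add_mono mult_left_mono ly)
      have "1 * 1 \<le> x\<^sup>2 * \<Lambda>" using x1 \<Lambda>1 by (intro mult_mono) (auto simp: one_le_power)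
      then show "1 \<le> x\<^sup>2 * \<Lambda>" by simp
    qed auto
    finally show ?thesis by (simp add: mult_ac)
  qed
  have "real N * (real k * real m * real n) \<le> 7 * x * \<Lambda> * (real k * (65 * x\<^sup>2 * \<Lambda>) * real n)"
    using N m x1 \<Lambda>1 by (intro mult_mono) auto
  also have "\<dots> = 455 * T * \<Lambda>\<^sup>2"
    unfolding Tx by (simp add: power_numeral_reduce)
  finally have "real L * (real N * (real k * real m * real n)) \<le> 3 * \<Lambda> * (455 * T * \<Lambda>\<^sup>2)"
    using \<Lambda>1 T1 by (intro mult_mono[OF L]) auto
  then have A: "real L * (real N * (real k * real m * real n)) \<le> 1365 * (T * \<Lambda> ^ 3)"
    by (simp add: power_numeral_reduce mult_ac)
  have p: "1 \<le> \<Lambda> ^ 3" "\<Lambda>\<^sup>2 \<le> \<Lambda> ^ 3"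
    using \<Lambda>1 by (auto intro: one_le_power power_increasing)
  have B: "real n \<le> T * \<Lambda> ^ 3" using one_le[OF p(1), of T] nT T1 by linarith
  have C: "1 \<le> T * \<Lambda> ^ 3" using B nk by linarith
  have "real L * real N \<le> 3 * \<Lambda> * (7 * x * \<Lambda>)"
    using L N \<Lambda>1 by (intro mult_mono) auto
  also have "\<dots> = 21 * (x * \<Lambda>\<^sup>2)" by (simp add: power2_eq_square)
  also have "\<dots> \<le> 21 * (T * \<Lambda> ^ 3)" using xT p x1 T1 by (intro mult_left_mono mult_mono) auto
  finally have D: "real L * real N \<le> 21 * (T * \<Lambda> ^ 3)" .
  show ?thesis
    using A B C D unfolding N_def m_def L_def \<Lambda>_def by simp
qed

lemma failure_probability:
  assumes "0 < \<epsilon>" "\<epsilon> < 1" "0 < k" "0 < n"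
  shows "real (num_steps k \<epsilon>) * (real (k * n) *
    (2 * exp (- (real (num_samples n k \<epsilon>) * \<epsilon>\<^sup>2 / (8 * (real k)\<^sup>2))))) \<le> 1 / real n"
    and "0 < num_samples n k \<epsilon>"
proof -
  define N where "N = num_steps k \<epsilon>"
  define y where "y = 2 * real k * (real n)\<^sup>2 * real N"
  have "2 \<le> 2 / \<epsilon>" using assms by (simp add: field_simps)
  moreover have "0 \<le> 2 * real k * harm k / \<epsilon>" using assms by (simp add: harm_nonneg)
  ultimately have N: "2 \<le> real N" unfolding N_def num_steps_def by linarith
  have "2 * 1 * 1\<^sup>2 * 1 \<le> y" unfolding y_def using assms N by (intro mult_mono power_mono) auto
  then have y: "1 < y" by simp
  let ?m = "num_samples n k \<epsilon>"
  have pos: "0 < 8 * (real k / \<epsilon>)\<^sup>2 * ln y" using y assms by simp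
  have m: "8 * (real k / \<epsilon>)\<^sup>2 * ln y \<le> real ?m"
    unfolding num_samples_def y_def N_def by linarith
  then show "0 < ?m" using pos by (metis gr0I not_less of_nat_0)
  have "ln y \<le> real ?m * \<epsilon>\<^sup>2 / (8 * (real k)\<^sup>2)"
    using m assms by (simp add: field_simps)
  then have "exp (- (real ?m * \<epsilon>\<^sup>2 / (8 * (real k)\<^sup>2))) \<le> exp (- ln y)" by simp
  also have "\<dots> = 1 / y" using y by (simp add: exp_minus inverse_eq_divide)
  finally have "real N * (real (k * n) * (2 * exp (- (real ?m * \<epsilon>\<^sup>2 / (8 * (real k)\<^sup>2))))) \<le>
      real N * (real (k * n) * (2 * (1 / y)))" by (intro mult_left_mono) auto
  also have "\<dots> = 1 / real n"
    unfolding y_def using assms N by (simp add: field_simps power2_eq_square)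
  finally show "real (num_steps k \<epsilon>) * (real (k * n) *
      (2 * exp (- (real ?m * \<epsilon>\<^sup>2 / (8 * (real k)\<^sup>2))))) \<le> 1 / real n"
    unfolding N_def .
qed

text \<open>Rounding 1/(\<phi> \<epsilon>) down gives a guess above \<phi> whose reciprocal
  \<open>j * \<epsilon>\<close> is within \<epsilon> of 1/\<phi>. In \<open>rho\<close> the
  reciprocal is multiplied by 1 - exp(-\<phi>), which is at most 1 and increases with \<phi>, so at
  most \<epsilon> is lost.\<close>

lemma guess_exists:
  assumes "0 < \<epsilon>" "0 < \<phi>" "\<phi> * \<epsilon> \<le> 1"
  shows "\<exists>j::nat. 0 < j \<and> real j \<le> 1 / (\<phi> * \<epsilon>) \<and> \<phi> \<le> 1 / (real j * \<epsilon>) \<and>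
    rho \<phi> - \<epsilon> \<le> rho (1 / (real j * \<epsilon>))"
proof -
  define j where "j = nat \<lfloor>1 / (\<phi> * \<epsilon>)\<rfloor>"
  have ge: "1 \<le> 1 / (\<phi> * \<epsilon>)" using assms by simp
  have j: "0 < j" "real j \<le> 1 / (\<phi> * \<epsilon>)" "1 / (\<phi> * \<epsilon>) \<le> real j + 1"
    using ge unfolding j_def by linarith+
  have \<phi>: "\<phi> \<le> 1 / (real j * \<epsilon>)" using j assms by (simp add: field_simps)
  have "rho \<phi> - \<epsilon> \<le> (1 - exp (- \<phi>)) * (1 / \<phi> - \<epsilon>)"
    using assms by (simp add: rho_def left_diff_distrib right_diff_distrib diff_divide_distrib)
  also have "\<dots> \<le> (1 - exp (- \<phi>)) * (real j * \<epsilon>)"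
    using j(3) assms by (intro mult_left_mono) (auto simp: field_simps)
  also have "\<dots> \<le> (1 - exp (- (1 / (real j * \<epsilon>)))) * (real j * \<epsilon>)"
    using \<phi> assms by (intro mult_right_mono) auto
  also have "\<dots> = rho (1 / (real j * \<epsilon>))" by (simp add: rho_def)
  finally show ?thesis using j \<phi> by blast
qed

section \<open>The right scale, the right guess and the final guarantee\<close>

context weakly_submodular_matroid
begin

lemma prob_return_best:
  assumes "set H \<subseteq> \<I>" "\<exists>A\<in>set H. P A"
  shows "measure_pmf.prob (output_pmf f (return_best H)) {S \<in> \<I>. \<exists>A. P A \<and> f A \<le> f S} = 1"
proof -
  let ?h = "answers f (set H)"
  define B where "B = (SOME A. A \<in> set H \<and> (\<forall>B\<in>set H. ?h B \<le> ?h A))"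
  have "\<exists>A. A \<in> set H \<and> (\<forall>B\<in>set H. ?h B \<le> ?h A)"
  proof -
    have "Max (?h ` set H) \<in> ?h ` set H" using assms(2) by (intro Max_in) auto
    then obtain A where "A \<in> set H" "?h A = Max (?h ` set H)" by (metis imageE)
    then show ?thesis by (intro exI[of _ A]) auto
  qed
  then have B: "B \<in> set H \<and> (\<forall>A\<in>set H. ?h A \<le> ?h B)" unfolding B_def by (rule someI_ex)
  have "output_pmf f (return_best H) = return_pmf B"
    by (simp add: return_best_def output_pmf_ask B_def)
  moreover have "B \<in> {S \<in> \<I>. \<exists>A. P A \<and> f A \<le> f S}"
    using B assms by (auto simp: answers_def)
  ultimately show ?thesis by simp
qed

lemma prob_scan_invariant:
  assumes "base S" "set H \<subseteq> \<I>" "\<exists>A\<in>set H. P A" "0 < \<epsilon>"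
  shows "1 \<le> measure_pmf.prob (output_pmf f (scan X \<I> \<epsilon> m N Zs S H)) {S \<in> \<I>. \<exists>A. P A \<and> f A \<le> f S}"
  using assms(1-3)
proof (induction Zs arbitrary: S H)
  case Nil
  then show ?case by (simp add: prob_return_best)
next
  case (Cons Z Zs)
  show ?case unfolding scan.simps
    by (rule prob_loop_invariant[where Q = "\<lambda>H. set H \<subseteq> \<I> \<and> (\<exists>A\<in>set H. P A)"])
      (use Cons assms(4) base_props(3) in auto)
qed

text \<open>Runs before the scale \<open>Z\<close> only have to hand over a base and independent
  sets; runs after it only have to keep the recorded base. The union bound therefore covers
  \<open>N\<close> steps, whatever the number of scales.\<close>

lemma prob_scan:
  fixes jstar :: nat and \<epsilon> Z :: real
  defines "\<tau> \<equiv> \<epsilon> * Z / real (matroid_rank \<I>)"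
  assumes P: "\<And>S. base S \<Longrightarrow> (\<And>s e. (s, e) \<in> swaps X \<I> S \<Longrightarrow>
       swap_gain (1 / (real jstar * \<epsilon>)) f S s e \<le> 3 * \<tau>) \<Longrightarrow> P S"
    and pos: "0 < m" "0 < Z" "0 < \<epsilon>" "0 < matroid_rank \<I>" "0 < jstar" and Z: "\<And>A. A \<in> \<I> \<Longrightarrow> f A \<le> 2 * Z"
    and N: "real jstar + 2 * real (matroid_rank \<I>) * harm (matroid_rank \<I>) / \<epsilon> \<le> real N"
    and S: "base S" "set H \<subseteq> \<I>" and mem: "Z \<in> set Zs"
  shows "1 - real N * (real (matroid_rank \<I> * card X) *
      (2 * exp (- (real m * \<epsilon>\<^sup>2 / (8 * (real (matroid_rank \<I>))\<^sup>2))))) \<le>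
    measure_pmf.prob (output_pmf f (scan X \<I> \<epsilon> m N Zs S H)) {S \<in> \<I>. \<exists>A. P A \<and> f A \<le> f S}"
    (is "?q \<le> _")
  using S mem
proof (induction Zs arbitrary: S H)
  case (Cons Z' Zs)
  show ?case
  proof (cases "Z' = Z")
    case True
    let ?k = "matroid_rank \<I>"
    have \<tau>: "0 < \<tau>" using pos by (simp add: \<tau>_def)
    have "1 - real N * (real (?k * card X) * (2 * exp (- (real m * \<tau>\<^sup>2 / (2 * (2 * Z)\<^sup>2))))) \<le>
        measure_pmf.prob (output_pmf f (loop X \<I> \<epsilon> \<tau> m (scan X \<I> \<epsilon> m N Zs) N S 1 H))
          {S \<in> \<I>. \<exists>A. P A \<and> f A \<le> f S}"
    proof (rule prob_loop_reaches[where M = "2 * Z" and jstar = jstar and P = P, OF _ _ _ _ _ _ _ _ refl])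
      have nonneg: "0 \<le> potential (1 / (real 1 * \<epsilon>)) f S"
        using base_props(2)[OF Cons.prems(1)] by (intro potential_nonneg f_nonneg) auto
      have "(harm ?k * (2 * Z) - potential (1 / (real 1 * \<epsilon>)) f S) / \<tau> \<le> harm ?k * (2 * Z) / \<tau>"
        using nonneg \<tau> by (intro divide_right_mono) auto
      also have "\<dots> = 2 * real ?k * harm ?k / \<epsilon>"
        using pos by (simp add: \<tau>_def field_simps)
      finally show "real jstar - real 1 + (harm ?k * (2 * Z) - potential (1 / (real 1 * \<epsilon>)) f S) / \<tau> \<le> real N - 1"
        using N by simp
      show "1 \<le> measure_pmf.prob (output_pmf f (scan X \<I> \<epsilon> m N Zs S' H')) {S \<in> \<I>. \<exists>A. P A \<and> f A \<le> f S}"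
        if "base S'" "set H' \<subseteq> \<I>" "\<exists>A\<in>set H'. P A" for S' H'
        using that pos(3) by (rule prob_scan_invariant)
      show "P S'" if "base S'" "\<And>s e. (s, e) \<in> swaps X \<I> S' \<Longrightarrow>
          swap_gain (1 / (real jstar * \<epsilon>)) f S' s e \<le> 3 * \<tau>" for S'
        using that by (rule P)
      show "f A \<le> 2 * Z" if "A \<in> \<I>" for A
        using that by (rule Z)
    qed (use pos \<tau> Cons.prems in auto)
    \<comment> \<open>The scale cancels, so the number of samples can be fixed without knowing
      it.\<close>
    moreover have "\<tau>\<^sup>2 / (2 * (2 * Z)\<^sup>2) = \<epsilon>\<^sup>2 / (8 * (real ?k)\<^sup>2)"
      using pos by (simp add: \<tau>_def field_simps power2_eq_square)
    then have "real m * \<tau>\<^sup>2 / (2 * (2 * Z)\<^sup>2) = real m * \<epsilon>\<^sup>2 / (8 * (real ?k)\<^sup>2)"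
      by (metis times_divide_eq_right)
    ultimately show ?thesis using True by (simp add: \<tau>_def)
  next
    case False
    have "?q \<le> 1" by simp
    show ?thesis unfolding scan.simps
      by (rule prob_loop_invariant[where Q = "\<lambda>H. set H \<subseteq> \<I>"])
        (use Cons False pos base_props(3) \<open>?q \<le> 1\<close> in auto)
  qed
qed simp

text \<open>If the ratio exceeds 4\<epsilon>, these give \<epsilon> \<le> \<gamma> and \<epsilon>
  \<le> \<open>rho (phi \<gamma> \<beta>)\<close>, the conditions under which the scales and the
  guesses suffice.\<close>

lemma ratio_bounds: "\<gamma>\<^sup>2 * rho (phi \<gamma> \<beta>) \<le> \<gamma>\<^sup>2" "\<gamma>\<^sup>2 * rho (phi \<gamma> \<beta>) \<le> rho (phi \<gamma> \<beta>)" "\<gamma>\<^sup>2 \<le> \<gamma>"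
proof -
  have "0 < phi \<gamma> \<beta>" using phi_ge_half by linarith
  note rho = rho_pos[OF this] rho_le_1[OF this]
  show "\<gamma>\<^sup>2 * rho (phi \<gamma> \<beta>) \<le> \<gamma>\<^sup>2" using rho by (intro mult_left_le) auto
  show "\<gamma>\<^sup>2 \<le> \<gamma>" using \<gamma> by (simp add: power2_eq_square mult_left_le)
  then have "\<gamma>\<^sup>2 \<le> 1" using \<gamma> by linarith
  then show "\<gamma>\<^sup>2 * rho (phi \<gamma> \<beta>) \<le> rho (phi \<gamma> \<beta>)" using rho by (intro mult_left_le_one_le) auto
qed

text \<open>Of the 4\<epsilon>, three come from gains of up to 3\<tau> for each of the k elements,
  with k \<tau> = \<epsilon> Z, and one from rounding \<open>phi\<close>.\<close>

definition approximates :: "real \<Rightarrow> 'a set \<Rightarrow> bool" where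
  "approximates \<epsilon> S \<longleftrightarrow> S \<in> \<I> \<and>
     (\<forall>Opt\<in>\<I>. (\<gamma>\<^sup>2 * rho (phi \<gamma> \<beta>) - 4 * \<epsilon>) * f Opt \<le> f S)"

lemma indep_f_nonneg: "A \<in> \<I> \<Longrightarrow> 0 \<le> f A"
  using f_nonneg indep_subset_ground by auto

lemma approximates_trivial:
  assumes "S \<in> \<I>" "\<gamma>\<^sup>2 * rho (phi \<gamma> \<beta>) \<le> 4 * \<epsilon> \<or> (\<forall>A\<in>\<I>. f A = 0)"
  shows "approximates \<epsilon> S"
  unfolding approximates_def
proof (intro conjI ballI)
  fix Opt assume "Opt \<in> \<I>"
  then have "(\<gamma>\<^sup>2 * rho (phi \<gamma> \<beta>) - 4 * \<epsilon>) * f Opt \<le> 0"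
    using assms(2) indep_f_nonneg by (auto intro: mult_nonpos_nonneg)
  also have "0 \<le> f S" using assms(1) by (rule indep_f_nonneg)
  finally show "(\<gamma>\<^sup>2 * rho (phi \<gamma> \<beta>) - 4 * \<epsilon>) * f Opt \<le> f S" .
qed (rule assms)

definition singletons :: "'a set set" where "singletons = (\<lambda>e. {e}) ` X \<inter> \<I>"

lemma finite_singletons: "finite singletons" "singletons \<subseteq> Pow X" "card singletons \<le> card X"
proof -
  show "finite singletons" "singletons \<subseteq> Pow X" using finite_ground by (auto simp: singletons_def)
  have "card singletons \<le> card ((\<lambda>e. {e}) ` X)"
    unfolding singletons_def using finite_ground by (intro card_mono) auto
  also have "\<dots> \<le> card X" using finite_ground by (rule card_image_le)
  finally show "card singletons \<le> card X" .
qed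

lemma singletons_nonempty:
  assumes "0 < matroid_rank \<I>"
  shows "singletons \<noteq> {}"
proof -
  obtain B where B: "base B" using base_exists by auto
  then have "B \<noteq> {}" using assms by (auto simp: base_def)
  then obtain e where "e \<in> B" by auto
  then have "{e} \<in> singletons"
    using base_props[OF B] indep_mono[of B "{e}"] by (auto simp: singletons_def)
  then show ?thesis by auto
qed

lemma opt_le_singletons:
  assumes "A \<in> \<I>" "0 < matroid_rank \<I>"
  shows "\<gamma> * f A \<le> real (matroid_rank \<I>) * Max (f ` singletons)"
proof -
  have fin: "finite (f ` singletons)" using finite_singletons by simp
  have le: "f {e} \<le> Max (f ` singletons)" if "e \<in> A" for e
  proof -
    have "{e} \<in> singletons"
      using that assms indep_subset_ground indep_mono[of A "{e}"] by (auto simp: singletons_def)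
    then show ?thesis using fin by auto
  qed
  obtain B where "B \<in> singletons" using singletons_nonempty[OF assms(2)] by auto
  then have "0 \<le> f B" "f B \<le> Max (f ` singletons)"
    using fin by (auto simp: singletons_def intro: indep_f_nonneg)
  then have Max0: "0 \<le> Max (f ` singletons)" by linarith
  have "\<gamma> * f A \<le> (\<Sum>e\<in>A. f {e})"
    using weak_lower[of "{}" A] indep_subset_ground[OF assms(1)] by (simp add: f_empty)
  also have "\<dots> \<le> real (card A) * Max (f ` singletons)"
    using sum_bounded_above[of A "\<lambda>e. f {e}"] le by simp
  also have "\<dots> \<le> real (matroid_rank \<I>) * Max (f ` singletons)"
    using card_le_rank[OF assms(1)] Max0 by (intro mult_right_mono) auto
  finally show ?thesis .
qed

lemma scale_exists:
  assumes "0 < \<epsilon>" "\<epsilon> \<le> \<gamma>" "0 < matroid_rank \<I>" "0 < Max (f ` singletons)"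
  shows "\<exists>i < num_scales (matroid_rank \<I>) \<epsilon>. let Z = Max (f ` singletons) * 2 ^ i in
    Z \<le> Max (f ` \<I>) \<and> Max (f ` \<I>) \<le> 2 * Z"
proof -
  let ?k = "matroid_rank \<I>"
  define \<mu> where "\<mu> = Max (f ` singletons)"
  define V where "V = Max (f ` \<I>)"
  have "\<mu> \<in> f ` singletons"
    unfolding \<mu>_def using finite_singletons singletons_nonempty[OF assms(3)] by (intro Max_in) auto
  then have "\<mu> \<in> f ` \<I>" by (auto simp: singletons_def)
  then have \<mu>V: "\<mu> \<le> V" unfolding V_def using finite_\<I> by auto
  have \<mu>: "0 < \<mu>" using assms by (simp add: \<mu>_def)
  have "V \<in> f ` \<I>" unfolding V_def using finite_\<I> indep_empty by (intro Max_in) auto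
  then have "\<gamma> * V \<le> real ?k * \<mu>" using opt_le_singletons assms by (auto simp: \<mu>_def)
  moreover have "\<epsilon> * V \<le> \<gamma> * V" using assms \<mu> \<mu>V by (intro mult_right_mono) auto
  ultimately have VV: "V / \<mu> \<le> real ?k / \<epsilon>" using \<mu> assms by (simp add: field_simps)
  have V1: "1 \<le> V / \<mu>" using \<mu> \<mu>V by simp
  define i where "i = nat \<lfloor>log 2 (V / \<mu>)\<rfloor>"
  have l0: "0 \<le> log 2 (V / \<mu>)" using V1 by simp
  then have i: "real i \<le> log 2 (V / \<mu>)" "log 2 (V / \<mu>) \<le> real (Suc i)"
    unfolding i_def by linarith+
  have "log 2 (V / \<mu>) \<le> log 2 (real ?k / \<epsilon>)" using VV V1 by simp
  then have "i < num_scales ?k \<epsilon>"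
    unfolding i_def num_scales_def by (simp add: floor_mono nat_mono less_Suc_eq_le)
  moreover have "\<mu> * 2 ^ i \<le> V"
  proof -
    have "2 powr real i \<le> 2 powr log 2 (V / \<mu>)" using i by simp
    then have "2 ^ i \<le> V / \<mu>" using V1 by (simp add: powr_realpow)
    then show ?thesis using \<mu> by (simp add: field_simps)
  qed
  moreover have "V \<le> 2 * (\<mu> * 2 ^ i)"
  proof -
    have "2 powr log 2 (V / \<mu>) \<le> 2 powr real (Suc i)" using i by simp
    then have "V / \<mu> \<le> 2 ^ Suc i" using V1 by (subst (asm) powr_realpow) auto
    then show ?thesis using \<mu> by (simp add: field_simps)
  qed
  ultimately show ?thesis unfolding Let_def \<mu>_def V_def by blast
qed

lemma local_optimum_approximates:
  assumes "0 < \<epsilon>" "0 < matroid_rank \<I>" "phi \<gamma> \<beta> \<le> \<phi>" "rho (phi \<gamma> \<beta>) - \<epsilon> \<le> rho \<phi>"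
    and Z: "0 < Z" "Z \<le> Max (f ` \<I>)"
    and A: "base A" "\<And>s e. (s, e) \<in> swaps X \<I> A \<Longrightarrow>
      swap_gain \<phi> f A s e \<le> 3 * (\<epsilon> * Z / real (matroid_rank \<I>))"
    and S: "S \<in> \<I>" "f A \<le> f S"
  shows "approximates \<epsilon> S"
proof (cases "\<gamma>\<^sup>2 * rho (phi \<gamma> \<beta>) \<le> 4 * \<epsilon>")
  case True
  then show ?thesis using S by (intro approximates_trivial) auto
next
  case False
  define V where "V = Max (f ` \<I>)"
  have "V \<in> f ` \<I>" unfolding V_def using finite_\<I> indep_empty by (intro Max_in) auto
  then obtain T' where T': "T' \<in> \<I>" "V = f T'" by auto
  obtain T where T: "base T" "T' \<subseteq> T" using extend_to_base[OF T'(1)] by auto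
  \<comment> \<open>By monotonicity the optimum is attained at a base, as the exchange bijection
    requires.\<close>
  have "V \<le> f T" using T T' f_mono base_props(2)[OF T(1)] by auto
  moreover have "f T \<le> V" unfolding V_def using base_props(3)[OF T(1)] finite_\<I> by auto
  ultimately have TV: "f T = V" by simp
  have V0: "0 \<le> V" using T' indep_f_nonneg by auto
  have "\<gamma>\<^sup>2 \<le> 1" using ratio_bounds(3) \<gamma> by linarith
  have "\<gamma>\<^sup>2 * (rho (phi \<gamma> \<beta>) - \<epsilon>) \<le> \<gamma>\<^sup>2 * rho \<phi>" using assms(4) by (intro mult_left_mono) auto
  moreover have "\<gamma>\<^sup>2 * \<epsilon> \<le> \<epsilon>" using \<open>\<gamma>\<^sup>2 \<le> 1\<close> assms(1) by (intro mult_left_le_one_le) auto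
  ultimately have "\<gamma>\<^sup>2 * rho (phi \<gamma> \<beta>) - \<epsilon> \<le> \<gamma>\<^sup>2 * rho \<phi>" by (simp add: algebra_simps)
  then have "(\<gamma>\<^sup>2 * rho (phi \<gamma> \<beta>) - \<epsilon>) * V \<le> \<gamma>\<^sup>2 * rho \<phi> * V" using V0 by (intro mult_right_mono)
  moreover have "rho \<phi> * \<gamma>\<^sup>2 * f T - real (matroid_rank \<I>) * (3 * (\<epsilon> * Z / real (matroid_rank \<I>))) \<le> f A"
    using A T assms by (intro local_optimum) (auto simp: swaps_def)
  moreover have "real (matroid_rank \<I>) * (3 * (\<epsilon> * Z / real (matroid_rank \<I>))) = 3 * (\<epsilon> * Z)"
    using assms(2) by simp
  moreover have "\<epsilon> * Z \<le> \<epsilon> * V" using Z assms(1) by (simp add: V_def)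
  ultimately have main: "(\<gamma>\<^sup>2 * rho (phi \<gamma> \<beta>) - 4 * \<epsilon>) * V \<le> f A"
    unfolding TV by (simp add: algebra_simps)
  show ?thesis unfolding approximates_def
  proof (intro conjI ballI)
    fix Opt assume "Opt \<in> \<I>"
    then have "f Opt \<le> V" unfolding V_def using finite_\<I> by auto
    then have "(\<gamma>\<^sup>2 * rho (phi \<gamma> \<beta>) - 4 * \<epsilon>) * f Opt \<le> (\<gamma>\<^sup>2 * rho (phi \<gamma> \<beta>) - 4 * \<epsilon>) * V"
      using False by (intro mult_left_mono) auto
    then show "(\<gamma>\<^sup>2 * rho (phi \<gamma> \<beta>) - 4 * \<epsilon>) * f Opt \<le> f S" using main S by linarith
  qed (rule S)
qed

lemma prob_local_search:
  assumes "0 < \<epsilon>"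
  shows "1 - 1 / real (card X) \<le> measure_pmf.prob (output_pmf f (local_search X \<I> \<epsilon>)) {S. approximates \<epsilon> S}"
proof (cases "1 \<le> \<epsilon> \<or> matroid_rank \<I> = 0")
  case True
  have "\<gamma>\<^sup>2 * rho (phi \<gamma> \<beta>) \<le> 4 * \<epsilon> \<or> (\<forall>A\<in>\<I>. f A = 0)"
  proof (cases "1 \<le> \<epsilon>")
    case True
    then show ?thesis using ratio_bounds \<gamma> by linarith
  next
    case False
    then have "A = {}" if "A \<in> \<I>" for A
      using True card_le_rank[OF that] finite_indep[OF that] by auto
    then show ?thesis using f_empty by auto
  qed
  then have "approximates \<epsilon> {}" using indep_empty by (rule approximates_trivial[rotated])
  \<comment> \<open>Success is certain in this branch. It includes an empty ground set, where
    \<open>1 / real (card X)\<close> is 0.\<close>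
  then have "measure_pmf.prob (output_pmf f (local_search X \<I> \<epsilon>)) {S. approximates \<epsilon> S} = 1"
    using True by (simp add: local_search_def)
  then show ?thesis by simp
next
  case False
  define k where "k = matroid_rank \<I>"
  define n where "n = card X"
  define S0 where "S0 = (SOME S. S \<in> \<I> \<and> card S = k)"
  define \<mu> where "\<mu> = Max (f ` singletons)"
  define Zs where "Zs = map (\<lambda>i. \<mu> * 2 ^ i) [0..<num_scales k \<epsilon>]"
  define m where "m = num_samples n k \<epsilon>"
  define N where "N = num_steps k \<epsilon>"
  have \<epsilon>: "\<epsilon> < 1" and k: "0 < k" using False by (auto simp: k_def)
  have S0: "base S0"
    unfolding base_def S0_def k_def by (rule someI_ex) (use base_exists in \<open>auto simp: base_def\<close>)
  have "S0 \<noteq> {}" using S0 k by (auto simp: base_def k_def)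
  then have n: "0 < n" using base_props(2)[OF S0] finite_ground by (auto simp: n_def card_gt_0_iff)
  have "answers f singletons ` singletons = f ` singletons" by (auto simp: answers_def)
  then have out: "output_pmf f (local_search X \<I> \<epsilon>) = output_pmf f (scan X \<I> \<epsilon> m N Zs S0 [S0])"
    using False finite_singletons(1)
    by (simp add: local_search_def output_pmf_ask Let_def flip: singletons_def)
      (simp add: m_def N_def Zs_def \<mu>_def S0_def k_def n_def)
  have H: "set [S0] \<subseteq> \<I>" using base_props(3)[OF S0] by simp
  show ?thesis
  proof (cases "\<gamma>\<^sup>2 * rho (phi \<gamma> \<beta>) \<le> 4 * \<epsilon> \<or> (\<forall>A\<in>\<I>. f A = 0)")
    case True
    have "1 \<le> measure_pmf.prob (output_pmf f (scan X \<I> \<epsilon> m N Zs S0 [S0])) {S \<in> \<I>. \<exists>A. True \<and> f A \<le> f S}"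
      using S0 H assms by (intro prob_scan_invariant) auto
    also have "\<dots> \<le> measure_pmf.prob (output_pmf f (scan X \<I> \<epsilon> m N Zs S0 [S0])) {S. approximates \<epsilon> S}"
      using approximates_trivial[OF _ True] by (intro measure_pmf.finite_measure_mono) auto
    finally show ?thesis unfolding out by (rule order_trans[rotated]) simp
  next
    case nontriv: False
    have "\<epsilon> \<le> \<gamma>" "\<epsilon> \<le> rho (phi \<gamma> \<beta>)" using nontriv ratio_bounds assms by linarith+
    have phi0: "0 < phi \<gamma> \<beta>" using phi_ge_half by linarith
    have "rho (phi \<gamma> \<beta>) \<le> 1 / phi \<gamma> \<beta>"
      unfolding rho_def using phi0 by (intro divide_right_mono) auto
    then have "\<epsilon> \<le> 1 / phi \<gamma> \<beta>" using \<open>\<epsilon> \<le> rho (phi \<gamma> \<beta>)\<close> by linarith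
    then have "phi \<gamma> \<beta> * \<epsilon> \<le> 1" using phi0 by (simp add: field_simps)
    then obtain j :: nat where j: "0 < j" "real j \<le> 1 / (phi \<gamma> \<beta> * \<epsilon>)" "phi \<gamma> \<beta> \<le> 1 / (real j * \<epsilon>)"
        "rho (phi \<gamma> \<beta>) - \<epsilon> \<le> rho (1 / (real j * \<epsilon>))"
      using guess_exists[OF assms phi0] by auto
    have "1 / (phi \<gamma> \<beta> * \<epsilon>) \<le> 1 / (1 / 2 * \<epsilon>)"
      using phi_ge_half assms by (intro divide_left_mono mult_right_mono) auto
    then have j2: "real j \<le> 2 / \<epsilon>" using j(2) by simp
    obtain A where "A \<in> \<I>" "f A \<noteq> 0" using nontriv by auto
    \<comment> \<open>A nonzero value forces a positive singleton value; otherwise all scales would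
      be 0.\<close>
    then have "0 < \<gamma> * f A" using indep_f_nonneg[of A] \<gamma> by simp
    then have "0 < real k * \<mu>" using opt_le_singletons[OF \<open>A \<in> \<I>\<close>] k unfolding k_def \<mu>_def by linarith
    then have \<mu>: "0 < \<mu>" using k by (simp add: zero_less_mult_iff)
    obtain i where i: "i < num_scales k \<epsilon>" "\<mu> * 2 ^ i \<le> Max (f ` \<I>)" "Max (f ` \<I>) \<le> 2 * (\<mu> * 2 ^ i)"
      using scale_exists[OF assms \<open>\<epsilon> \<le> \<gamma>\<close>] k \<mu> unfolding k_def \<mu>_def Let_def by auto
    define Z where "Z = \<mu> * 2 ^ i"
    have Z: "0 < Z" "Z \<le> Max (f ` \<I>)" "Z \<in> set Zs" using i \<mu> by (auto simp: Z_def Zs_def)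
    have Z2: "f A \<le> 2 * Z" if "A \<in> \<I>" for A
    proof -
      have "f A \<le> Max (f ` \<I>)" using that finite_\<I> by auto
      then show ?thesis using i(3) by (simp add: Z_def)
    qed
    let ?P = "\<lambda>A. base A \<and> (\<forall>(s, e)\<in>swaps X \<I> A.
        swap_gain (1 / (real j * \<epsilon>)) f A s e \<le> 3 * (\<epsilon> * Z / real (matroid_rank \<I>)))"
    have "1 - 1 / real n \<le> 1 - real N * (real (matroid_rank \<I> * card X) *
        (2 * exp (- (real m * \<epsilon>\<^sup>2 / (8 * (real (matroid_rank \<I>))\<^sup>2)))))"
      using failure_probability(1)[OF assms \<epsilon> k n]
      unfolding N_def[symmetric] m_def[symmetric] unfolding k_def n_def by simp
    also have "\<dots> \<le> measure_pmf.prob (output_pmf f (scan X \<I> \<epsilon> m N Zs S0 [S0]))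
        {S \<in> \<I>. \<exists>A. ?P A \<and> f A \<le> f S}"
    proof (rule prob_scan[where Z = Z and jstar = j])
      show "real j + 2 * real (matroid_rank \<I>) * harm (matroid_rank \<I>) / \<epsilon> \<le> real N"
        using j2 unfolding N_def num_steps_def k_def by linarith
      show "0 < m" unfolding m_def by (rule failure_probability(2)[OF assms \<epsilon> k n])
      show "f A \<le> 2 * Z" if "A \<in> \<I>" for A using that by (rule Z2)
    qed (use Z S0 H assms k j in \<open>auto simp: k_def\<close>)
    also have "\<dots> \<le> measure_pmf.prob (output_pmf f (scan X \<I> \<epsilon> m N Zs S0 [S0])) {S. approximates \<epsilon> S}"
    proof (intro measure_pmf.finite_measure_mono subsetI)
      fix S assume "S \<in> {S \<in> \<I>. \<exists>A. ?P A \<and> f A \<le> f S}"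
      then obtain A where "S \<in> \<I>" "?P A" "f A \<le> f S" by auto
      then have "approximates \<epsilon> S"
        using k by (intro local_optimum_approximates[OF assms _ j(3,4) Z(1,2), of A]) (auto simp: k_def)
      then show "S \<in> {S. approximates \<epsilon> S}" by simp
    qed simp
    finally show ?thesis unfolding out n_def .
  qed
qed

lemma queries_le_local_search:
  assumes "0 < \<epsilon>"
  defines "T \<equiv> real (card X) * real (matroid_rank \<I>) ^ 4 / \<epsilon> ^ 3"
  shows "\<forall>(S, qs)\<in>set_pmf (exec f (local_search X \<I> \<epsilon>)).
    set qs \<subseteq> Pow X \<and> real (length qs) \<le> 1388 * T * ln (2 + T) ^ 3"
proof (cases "1 \<le> \<epsilon> \<or> matroid_rank \<I> = 0")
  case True
  have "0 \<le> T" using assms by simp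
  then have "0 \<le> 1388 * T * ln (2 + T) ^ 3" by simp
  then show ?thesis using True by (simp add: local_search_def)
next
  case False
  define k where "k = matroid_rank \<I>"
  define n where "n = card X"
  define S0 where "S0 = (SOME S. S \<in> \<I> \<and> card S = k)"
  have \<epsilon>: "\<epsilon> < 1" and k: "0 < k" using False by (auto simp: k_def)
  have S0: "base S0"
    unfolding base_def S0_def k_def by (rule someI_ex) (use base_exists in \<open>auto simp: base_def\<close>)
  have "S0 \<noteq> {}" using S0 k by (auto simp: base_def k_def)
  then have n: "0 < n" using base_props(2)[OF S0] finite_ground by (auto simp: n_def card_gt_0_iff)
  let ?b = "num_scales k \<epsilon> * (num_steps k \<epsilon> * (k * num_samples n k \<epsilon> * n)) +
      (1 + num_scales k \<epsilon> * num_steps k \<epsilon>)"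
  have le: "queries_le X f (local_search X \<I> \<epsilon>) (n + ?b)"
  proof -
    have "queries_le X f (scan X \<I> \<epsilon> (num_samples n k \<epsilon>) (num_steps k \<epsilon>)
        (map g [0..<num_scales k \<epsilon>]) S0 [S0]) ?b" for g
      using queries_le_scan[OF S0, of "[S0]" \<epsilon> f "num_samples n k \<epsilon>" "num_steps k \<epsilon>" "map g [0..<num_scales k \<epsilon>]"]
        base_props(3)[OF S0] assms by (simp add: k_def n_def)
    then have "queries_le X f (ask singletons (\<lambda>h. scan X \<I> \<epsilon> (num_samples n k \<epsilon>) (num_steps k \<epsilon>)
        (map (\<lambda>i. Max (h ` singletons) * 2 ^ i) [0..<num_scales k \<epsilon>]) S0 [S0])) (n + ?b)"
      using finite_singletons by (intro queries_le_ask) (auto simp: n_def)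
    then show ?thesis using False
      by (simp add: local_search_def Let_def k_def n_def S0_def flip: singletons_def)
  qed
  have budget: "real (n + ?b) \<le> 1388 * T * ln (2 + T) ^ 3"
    using query_budget[OF assms(1) \<epsilon> k n] unfolding T_def k_def n_def .
  have "set qs \<subseteq> Pow X \<and> real (length qs) \<le> 1388 * T * ln (2 + T) ^ 3"
    if "(S, qs) \<in> set_pmf (exec f (local_search X \<I> \<epsilon>))" for S qs
  proof -
    have "set qs \<subseteq> Pow X \<and> length qs \<le> n + ?b" using le that unfolding queries_le_def by blast
    then show ?thesis using budget by (meson of_nat_mono order_trans)
  qed
  then show ?thesis by blast
qed

end

theorem theorem4:
  shows "\<exists>(alg :: 'a set \<Rightarrow> 'a set set \<Rightarrow> real \<Rightarrow> 'a oracle_alg)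
            (c :: real) (C :: real) (d :: nat) (\<delta> :: nat \<Rightarrow> real).
    0 < c \<and> 0 < C \<and> \<delta> \<longlonglongrightarrow> 0 \<and>
    (\<forall>(X :: 'a set) \<I> n k \<epsilon> f \<gamma> \<beta>.
       matroid X \<I> \<and> card X = n \<and> matroid_rank \<I> = k \<and> 0 < \<epsilon> \<and>
       0 < \<gamma> \<and> \<gamma> \<le> 1 \<and> 1 \<le> \<beta> \<and>
       nonneg_set_fun X f \<and> monotone_set_fun X f \<and> normalized_set_fun f \<and>
       weakly_submodular \<gamma> \<beta> X f \<longrightarrow>
         measure_pmf.prob (exec f (alg X \<I> \<epsilon>))
           {(S, qs). S \<in> \<I> \<and>
              (\<forall>Opt\<in>\<I>. f S \<ge>
                 (\<gamma>\<^sup>2 * (1 - exp (- phi \<gamma> \<beta>)) / phi \<gamma> \<beta> - c * \<epsilon>) * f Opt)}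
           \<ge> 1 - \<delta> n \<and>
         (\<forall>(S, qs)\<in>set_pmf (exec f (alg X \<I> \<epsilon>)).
            set qs \<subseteq> Pow X \<and>
            (let T = real n * real k ^ 4 / \<epsilon> ^ 3
             in real (length qs) \<le> C * T * ln (2 + T) ^ d)))"
proof -
  have main: "measure_pmf.prob (exec f (local_search X \<I> \<epsilon>))
           {(S, qs). S \<in> \<I> \<and>
              (\<forall>Opt\<in>\<I>. f S \<ge>
                 (\<gamma>\<^sup>2 * (1 - exp (- phi \<gamma> \<beta>)) / phi \<gamma> \<beta> - 4 * \<epsilon>) * f Opt)}
           \<ge> 1 - 1 / real n \<and>
         (\<forall>(S, qs)\<in>set_pmf (exec f (local_search X \<I> \<epsilon>)).
            set qs \<subseteq> Pow X \<and>
            (let T = real n * real k ^ 4 / \<epsilon> ^ 3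
             in real (length qs) \<le> 1388 * T * ln (2 + T) ^ 3))"
    if asm: "matroid X \<I>" "card X = n" "matroid_rank \<I> = k" "0 < \<epsilon>" "0 < \<gamma>" "\<gamma> \<le> 1" "1 \<le> \<beta>"
       "nonneg_set_fun X f" "monotone_set_fun X f" "normalized_set_fun f" "weakly_submodular \<gamma> \<beta> X f"
    for X :: "'a set" and \<I> n k \<epsilon> f \<gamma> \<beta>
  proof -
    interpret weakly_submodular_matroid X \<I> f \<gamma> \<beta>
      using asm by (intro weakly_submodular_matroid.intro weakly_submodular_matroid_axioms.intro)
    have "1 - 1 / real n \<le> measure_pmf.prob (exec f (local_search X \<I> \<epsilon>)) (fst -` {S. approximates \<epsilon> S})"
      using prob_local_search[OF asm(4)] asm(2) by (simp add: output_pmf_def)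
    also have "fst -` {S. approximates \<epsilon> S} = {(S, qs). S \<in> \<I> \<and>
        (\<forall>Opt\<in>\<I>. f S \<ge> (\<gamma>\<^sup>2 * (1 - exp (- phi \<gamma> \<beta>)) / phi \<gamma> \<beta> - 4 * \<epsilon>) * f Opt)}"
      by (auto simp: approximates_def rho_def)
    finally show ?thesis
      using queries_le_local_search[OF asm(4)] unfolding Let_def asm(2,3) by blast
  qed
  show ?thesis
    \<comment> \<open>The exponent 3 counts one logarithm each from the scales, the steps and the
      samples.\<close>
    by (rule exI[of _ local_search], rule exI[of _ 4], rule exI[of _ 1388], rule exI[of _ 3],
        rule exI[of _ "\<lambda>n. 1 / real n"], rule conjI[OF zero_less_numeral],
        rule conjI[OF zero_less_numeral], rule conjI[OF lim_1_over_n], intro allI impI, elim conjE)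
      (rule main)
qed

end
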